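(* For every $q\ge 3$ and $\sigma,\delta>0$, there exists $\epsilon>0$ with the following property: every $n$-vertex instance $G$ of Vertex Deletion to $q$-Coloring, given with a $(\sigma,\delta)$-hub of size $p$, can be solved in time $(q+1-\epsilon)^p\cdot n^{\mathcal{O}(1)}$.
   Context: For a graph $G$, a set $Q\subseteq V(G)$ is a $(\sigma,\delta)$-hub of $G$ if every connected component of $G-Q$ has at most $\sigma$ vertices and each such component is adjacent to at most $\delta$ vertices of $Q$. Vertex Deletion to $q$-Coloring: given a graph $G$, find a minimum-size set $X\subseteq V(G)$ such that $G-X$ admits a proper $q$-coloring. *)

theory Defs
  imports Complex_Main "Graph_Theory.Graph_Theory"
begin

section \<open>Hubs and vertex deletion to \<open>q\<close>-colouring\<close>

text \<open>
  A finite simple graph is a \<open>pair_graph\<close>: finite, symmetric and loop-free, an edge \<open>uv\<close> being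
  the two arcs \<open>(u, v)\<close> and \<open>(v, u)\<close>. By symmetry the strongly connected components (\<open>sccs\<close>)
  of such a graph are its connected components.
\<close>

definition del_verts :: "'a pair_pre_digraph \<Rightarrow> 'a set \<Rightarrow> ('a, 'a \<times> 'a) pre_digraph" where
  "del_verts G X = with_proj G \<restriction> (pverts G - X)"

definition hub :: "nat \<Rightarrow> nat \<Rightarrow> 'a pair_pre_digraph \<Rightarrow> 'a set \<Rightarrow> bool" where
  "hub \<sigma> \<delta> G Q \<longleftrightarrow> Q \<subseteq> pverts G \<and>
     (\<forall>C \<in> pre_digraph.sccs (del_verts G Q).
        card (verts C) \<le> \<sigma> \<and>
        card {v \<in> Q. \<exists>u \<in> verts C. (u, v) \<in> parcs G} \<le> \<delta>)"

definition proper_coloring :: "nat \<Rightarrow> ('a, 'b) pre_digraph \<Rightarrow> ('a \<Rightarrow> nat) \<Rightarrow> bool" where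
  "proper_coloring q H f \<longleftrightarrow>
     (\<forall>v \<in> verts H. f v < q) \<and> (\<forall>(u, v) \<in> arcs_ends H. f u \<noteq> f v)"

definition coloring_deletion_set :: "nat \<Rightarrow> 'a pair_pre_digraph \<Rightarrow> 'a set \<Rightarrow> bool" where
  "coloring_deletion_set q G X \<longleftrightarrow>
     X \<subseteq> pverts G \<and> (\<exists>f. proper_coloring q (del_verts G X) f)"

definition min_coloring_deletion_set :: "nat \<Rightarrow> 'a pair_pre_digraph \<Rightarrow> 'a set \<Rightarrow> bool" where
  "min_coloring_deletion_set q G X \<longleftrightarrow> is_arg_min card (coloring_deletion_set q G) X"


section \<open>The machine model\<close>

text \<open>
  Running time is measured in a first-order functional language over binary trees (pure
  first-order LISP; cf. N. D. Jones, \<^emph>\<open>Computability and Complexity from a Programming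
  Perspective\<close>). A program is a finite list of function bodies, which may call each other
  recursively; function 0 is the main function. In a body, \<open>EVar i\<close> is the \<open>i\<close>-th entry of the
  environment, which initially consists of the arguments and is extended at the front by \<open>ELet\<close>.
  In conditionals, \<open>Leaf\<close> counts as false and every other tree as true.

  Every evaluation step costs one unit. This is a realistic measure: trees can be represented by
  pointers to immutable nodes, trees are never compared or copied as a whole, and environments
  have a size bounded by the program, so each step takes constantly many pointer operations.
  Conversely, a random access memory with \<open>m\<close> cells can be kept in a balanced tree at a cost
  of \<open>O(log m)\<close> per access. Hence time \<open>T\<close> here and time \<open>T\<close> on a RAM agree up
  to a factor polynomial in \<open>log T\<close>; for \<open>T\<close> of the form \<open>a\<^sup>p n\<^sup>c\<close> with
  \<open>p \<le> n\<close> this factor is polynomial in \<open>n\<close>.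
\<close>

datatype sexp = Leaf | Node sexp sexp

primrec left :: "sexp \<Rightarrow> sexp" where
  "left Leaf = Leaf"
| "left (Node l r) = l"

primrec right :: "sexp \<Rightarrow> sexp" where
  "right Leaf = Leaf"
| "right (Node l r) = r"

datatype exp =
    EVar nat
  | ELeaf
  | ENode exp exp
  | ELeft exp
  | ERight exp
  | EIf exp exp exp
  | ELet exp exp
  | ECall nat "exp list"

type_synonym program = "exp list"

text \<open>
  \<open>eval P env e v t\<close>: in the environment \<open>env\<close>, the expression \<open>e\<close> evaluates to
  \<open>v\<close> in exactly \<open>t\<close> steps. There is no such \<open>v\<close> and \<open>t\<close> if the evaluation
  diverges or refers to an undefined variable or function.
\<close>

inductive eval :: "program \<Rightarrow> sexp list \<Rightarrow> exp \<Rightarrow> sexp \<Rightarrow> nat \<Rightarrow> bool"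
  and evals :: "program \<Rightarrow> sexp list \<Rightarrow> exp list \<Rightarrow> sexp list \<Rightarrow> nat \<Rightarrow> bool"
  for P :: program
where
  Var: "i < length env \<Longrightarrow> eval P env (EVar i) (env ! i) 1"
| Leaf: "eval P env ELeaf Leaf 1"
| Node: "eval P env e1 v1 t1 \<Longrightarrow> eval P env e2 v2 t2 \<Longrightarrow>
    eval P env (ENode e1 e2) (Node v1 v2) (t1 + t2 + 1)"
| Left: "eval P env e v t \<Longrightarrow> eval P env (ELeft e) (left v) (t + 1)"
| Right: "eval P env e v t \<Longrightarrow> eval P env (ERight e) (right v) (t + 1)"
| IfTrue: "eval P env b v t1 \<Longrightarrow> v \<noteq> Leaf \<Longrightarrow> eval P env e1 w t2 \<Longrightarrow>
    eval P env (EIf b e1 e2) w (t1 + t2 + 1)"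
| IfFalse: "eval P env b v t1 \<Longrightarrow> v = Leaf \<Longrightarrow> eval P env e2 w t2 \<Longrightarrow>
    eval P env (EIf b e1 e2) w (t1 + t2 + 1)"
| Let: "eval P env e1 v t1 \<Longrightarrow> eval P (v # env) e2 w t2 \<Longrightarrow>
    eval P env (ELet e1 e2) w (t1 + t2 + 1)"
| Call: "evals P env es vs t1 \<Longrightarrow> f < length P \<Longrightarrow> eval P vs (P ! f) w t2 \<Longrightarrow>
    eval P env (ECall f es) w (t1 + t2 + 1)"
| Nil: "evals P env [] [] 0"
| Cons: "eval P env e v t1 \<Longrightarrow> evals P env es vs t2 \<Longrightarrow>
    evals P env (e # es) (v # vs) (t1 + t2)"

inductive_cases eval_elims:
  "eval P env (EVar i) v t"
  "eval P env ELeaf v t"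
  "eval P env (ENode e1 e2) v t"
  "eval P env (ELeft e) v t"
  "eval P env (ERight e) v t"
  "eval P env (EIf b e1 e2) v t"
  "eval P env (ELet e1 e2) v t"
  "eval P env (ECall f es) v t"
  "evals P env [] vs t"
  "evals P env (e # es) vs t"

lemma eval_deterministic:
  "eval P env e v t \<Longrightarrow> eval P env e v' t' \<Longrightarrow> v' = v \<and> t' = t"
  "evals P env es vs t \<Longrightarrow> evals P env es vs' t' \<Longrightarrow> vs' = vs \<and> t' = t"
proof (induction arbitrary: v' t' and vs' t' rule: eval_evals.inducts)
  case Var
  then show ?case by (auto elim: eval_elims(1))
next
  case Leaf
  then show ?case by (auto elim: eval_elims(2))
next
  case Node
  from Node.prems Node.IH show ?case by (elim eval_elims(3)) (metis Suc_eq_plus1)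
next
  case Left
  from Left.prems Left.IH show ?case by (elim eval_elims(4)) (metis Suc_eq_plus1)
next
  case Right
  from Right.prems Right.IH show ?case by (elim eval_elims(5)) (metis Suc_eq_plus1)
next
  case IfTrue
  from IfTrue.prems IfTrue.IH IfTrue.hyps show ?case by (elim eval_elims(6)) (metis Suc_eq_plus1)+
next
  case IfFalse
  from IfFalse.prems IfFalse.IH IfFalse.hyps show ?case by (elim eval_elims(6)) (metis Suc_eq_plus1)+
next
  case Let
  from Let.prems Let.IH show ?case by (elim eval_elims(7)) (metis Suc_eq_plus1)
next
  case Call
  from Call.prems Call.IH show ?case by (elim eval_elims(8)) (metis Suc_eq_plus1)
next
  case Nil
  then show ?case by (auto elim: eval_elims(9))
next
  case Cons
  from Cons.prems Cons.IH show ?case by (elim eval_elims(10)) (metis Suc_eq_plus1)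
qed

definition computes_in :: "program \<Rightarrow> sexp \<Rightarrow> sexp \<Rightarrow> nat \<Rightarrow> bool" where
  "computes_in P x y t \<longleftrightarrow> P \<noteq> [] \<and> eval P [x] (P ! 0) y t"


section \<open>Encoding of instances\<close>

text \<open>
  A graph with vertex set \<open>{..<n}\<close> is given by its adjacency matrix, a vertex set by its
  characteristic vector.
\<close>

definition enc_bool :: "bool \<Rightarrow> sexp" where
  "enc_bool b = (if b then Node Leaf Leaf else Leaf)"

definition enc_list :: "sexp list \<Rightarrow> sexp" where
  "enc_list xs = foldr Node xs Leaf"

definition enc_set :: "nat \<Rightarrow> nat set \<Rightarrow> sexp" where
  "enc_set n S = enc_list (map (\<lambda>v. enc_bool (v \<in> S)) [0..<n])"

definition enc_graph :: "nat \<Rightarrow> nat pair_pre_digraph \<Rightarrow> sexp" where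
  "enc_graph n G = enc_list (map (\<lambda>u. enc_set n {v. (u, v) \<in> parcs G}) [0..<n])"

definition enc_instance :: "nat \<Rightarrow> nat pair_pre_digraph \<Rightarrow> nat set \<Rightarrow> sexp" where
  "enc_instance n G Q = Node (enc_graph n G) (enc_set n Q)"

end

theory Submission
  imports Defs
begin

text \<open>
  Take a solution of minimum size that deletes as many hub vertices as possible. Let \<open>C\<close> be a component
  of \<open>G - Q\<close> and let \<open>c(s)\<close> be the number of deletions needed inside \<open>C\<close> when its hub neighbours
  are coloured or deleted according to \<open>s\<close>. If deleting one more hub vertex \<open>u\<close> lowers \<open>c(s)\<close>, then
  \<open>s\<close> does not occur in this solution, since deleting \<open>u\<close> would not cost more in total. So if \<open>c\<close> is
  not constant, then one of the \<open>(q + 1)^k\<close> assignments of the \<open>k \<le> \<delta>\<close> free hub neighbours of \<open>C\<close>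
  can be discarded, and branching over the others takes at most \<open>(q + 1)^k - 1 \<le> (q + 1 - \<epsilon>)^k\<close>
  branches. An edge inside the hub is treated in the same way. If all the functions \<open>c\<close> are constant and
  no conflict inside the hub is left, then every free hub vertex can be given the first colour, and the
  components are solved independently.

  The search for a place to branch needs no components: it tries all lists \<open>W\<close> of at most
  \<open>\<sigma> + \<delta>\<close> vertices and counts the assignments of \<open>W\<close> that are not dominated by another one. Everything
  but the search tree itself is shown to be polynomial by closure properties of the polynomial-time
  functions on encoded data.
\<close>

section \<open>Polynomial time on encodable data\<close>

text \<open>The delicate point is to pay for hub vertices only. A list \<open>W\<close> made of a
  component and its \<open>k\<close> free hub neighbours has far more than (q + 1)^k assignments,
  yet the number of branches has to stay below (q + 1)^k. Strict dominance alone leaves ties between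
  equally cheap colourings of the component. Breaking the ties leaves at most one survivor for each
  choice on the hub part, so a single choice without a survivor brings the count down to (q + 1)^k -
  1. Component vertices thus become assigned along the way at no charge, and the exponent of the
  running time counts free hub vertices only.

  The number \<epsilon> depends on \<open>q\<close> and on \<sigma> + \<delta>, the maximum of a
  component together with its hub neighbours. One program has to serve all graphs, so the
  exponential search is a fixed program built around two polynomial-time subroutines, one that lists
  the children of a state and one that picks the cheaper of two results.\<close>

class encodable =
  fixes encode :: "'a \<Rightarrow> sexp"

instantiation unit :: encodable
begin
definition encode_unit_def [simp]: "encode (_ :: unit) = Leaf"
instance ..
end

instantiation bool :: encodable
begin
definition encode_bool_def: "encode = enc_bool"
instance ..
end

text \<open>Unary, so a number up to \<open>n\<close> has size at most \<open>n\<close>. The code of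
  \<open>n\<close> is also that of a list of \<open>n\<close> units, which turns recursion on
  numbers into recursion on lists.\<close>

instantiation nat :: encodable
begin
definition encode_nat_def: "encode n = enc_list (replicate n Leaf)"
instance ..
end

instantiation prod :: (encodable, encodable) encodable
begin
definition encode_prod_def: "encode p = Node (encode (fst p)) (encode (snd p))"
instance ..
end

instantiation list :: (encodable) encodable
begin
definition encode_list_def: "encode xs = enc_list (map encode xs)"
instance ..
end

lemma encode_simps [simp]:
  "encode True = Node Leaf Leaf"
  "encode False = Leaf"
  "encode (0 :: nat) = Leaf"
  "encode (Suc n) = Node Leaf (encode n)"
  "encode (x, y) = Node (encode x) (encode y)"
  "encode ([] :: 'a :: encodable list) = Leaf"
  "encode ((z :: 'a :: encodable) # zs) = Node (encode z) (encode zs)"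
  by (simp_all add: encode_bool_def encode_nat_def encode_prod_def encode_list_def enc_bool_def enc_list_def)

abbreviation esize :: "'a :: encodable \<Rightarrow> nat" where
  "esize x \<equiv> size (encode x)"

lemma esize_nat [simp]: "esize (n :: nat) = n"
  by (induction n) auto

lemma esize_prod: "esize p = esize (fst p) + esize (snd p) + 1"
  by (cases p) auto

lemma esize_list: "esize xs = (\<Sum>x\<leftarrow>xs. esize x) + length xs"
  by (induction xs) auto

lemma esize_mem: "x \<in> set xs \<Longrightarrow> esize x < esize xs"
  by (induction xs) auto

lemma length_le_esize: "length xs \<le> esize xs"
  by (simp add: esize_list)

lemma esize_list_le:
  assumes "\<And>x. x \<in> set xs \<Longrightarrow> esize x \<le> b" and "length xs \<le> l"
  shows "esize xs \<le> l * (b + 1)"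
proof -
  have "esize xs \<le> length xs * (b + 1)"
    using assms(1) by (induction xs) fastforce+
  also have "\<dots> \<le> l * (b + 1)"
    using assms(2) by (rule mult_le_mono1)
  finally show ?thesis .
qed

section \<open>Polynomial bounds in a size measure\<close>

definition poly_in :: "('a \<Rightarrow> nat) \<Rightarrow> ('a \<Rightarrow> nat) \<Rightarrow> bool" where
  "poly_in s f \<longleftrightarrow> (\<exists>c. \<forall>x. f x \<le> c * (s x + 1) ^ c)"

lemma poly_inI: "(\<And>x. f x \<le> c * (s x + 1) ^ d) \<Longrightarrow> poly_in s f"
proof -
  assume *: "\<And>x. f x \<le> c * (s x + 1) ^ d"
  have "f x \<le> (c + d) * (s x + 1) ^ (c + d)" for x
    using *[of x] by (rule order_trans) (intro mult_le_mono power_increasing; simp)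
  then show ?thesis unfolding poly_in_def by blast
qed

lemma poly_in_le: "poly_in s g \<Longrightarrow> (\<And>x. f x \<le> g x) \<Longrightarrow> poly_in s f"
  unfolding poly_in_def by (meson order_trans)

lemma poly_in_const: "poly_in s (\<lambda>_. k)"
  by (rule poly_inI[where c = k and d = 0]) simp

lemma poly_in_self: "poly_in s s"
  by (rule poly_inI[where c = 1 and d = 1]) simp

lemma poly_in_add:
  assumes "poly_in s f" "poly_in s g" shows "poly_in s (\<lambda>x. f x + g x)"
proof -
  from assms obtain c d where c: "\<And>x. f x \<le> c * (s x + 1) ^ c" and d: "\<And>x. g x \<le> d * (s x + 1) ^ d"
    unfolding poly_in_def by blast
  have "f x + g x \<le> (c + d) * (s x + 1) ^ (c + d)" for x
  proof -
    have "f x \<le> c * (s x + 1) ^ (c + d)"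
      by (rule order_trans[OF c]) (intro mult_le_mono power_increasing; simp)
    moreover have "g x \<le> d * (s x + 1) ^ (c + d)"
      by (rule order_trans[OF d]) (intro mult_le_mono power_increasing; simp)
    ultimately show ?thesis by (simp add: algebra_simps)
  qed
  then show ?thesis unfolding poly_in_def by blast
qed

lemma poly_in_mult:
  assumes "poly_in s f" "poly_in s g" shows "poly_in s (\<lambda>x. f x * g x)"
proof -
  from assms obtain c d where c: "\<And>x. f x \<le> c * (s x + 1) ^ c" and d: "\<And>x. g x \<le> d * (s x + 1) ^ d"
    unfolding poly_in_def by blast
  have "f x * g x \<le> (c * d) * (s x + 1) ^ (c + d)" for x
    using mult_le_mono[OF c[of x] d[of x]] by (simp add: power_add mult_ac)
  then show ?thesis by (rule poly_inI)
qed

lemma poly_in_power: "poly_in s f \<Longrightarrow> poly_in s (\<lambda>x. f x ^ k)"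
  by (induction k) (auto intro: poly_in_const poly_in_mult)

lemma poly_in_trans:
  assumes "poly_in g f" "poly_in s g" shows "poly_in s f"
proof -
  from assms(1) obtain c where c: "\<And>x. f x \<le> c * (g x + 1) ^ c"
    unfolding poly_in_def by blast
  have "poly_in s (\<lambda>x. c * (g x + 1) ^ c)"
    by (intro poly_in_mult poly_in_power poly_in_add poly_in_const assms)
  then show ?thesis using c by (rule poly_in_le)
qed

lemma poly_in_comp:
  assumes "poly_in s f" shows "poly_in (\<lambda>x. s (h x)) (\<lambda>x. f (h x))"
proof -
  from assms obtain c where "\<forall>x. f x \<le> c * (s x + 1) ^ c" unfolding poly_in_def ..
  then show ?thesis unfolding poly_in_def by (intro exI[of _ c]) simp
qed

named_theorems poly_intros
lemmas [poly_intros] = poly_in_const poly_in_self poly_in_add poly_in_mult poly_in_power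

text \<open>Time alone does not bound the size of a tree built with sharing, as
  \<open>ENode (EVar 0) (EVar 0)\<close> doubles a tree at constant cost. The size bound is what
  lets time bounds be composed.\<close>

definition ptime :: "('a :: encodable \<Rightarrow> 'b :: encodable) \<Rightarrow> bool" where
  "ptime f \<longleftrightarrow> (\<exists>P T. (\<forall>x. \<exists>t\<le>T x. computes_in P (encode x) (encode (f x)) t) \<and>
     poly_in esize T \<and> poly_in esize (\<lambda>x. esize (f x)))"

lemma ptime_size: "ptime f \<Longrightarrow> poly_in esize (\<lambda>x. esize (f x))"
  unfolding ptime_def by blast

lemma ptimeE:
  assumes "ptime f"
  obtains P c where "\<And>x. \<exists>t \<le> c * (esize x + 1) ^ c. computes_in P (encode x) (encode (f x)) t"
proof -
  from assms obtain P T where P: "\<forall>x. \<exists>t\<le>T x. computes_in P (encode x) (encode (f x)) t" and "poly_in esize T"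
    unfolding ptime_def by blast
  then obtain c where "\<And>x. T x \<le> c * (esize x + 1) ^ c" unfolding poly_in_def by blast
  then have "\<exists>t \<le> c * (esize x + 1) ^ c. computes_in P (encode x) (encode (f x)) t" for x
    using P by (meson order_trans)
  then show thesis using that by blast
qed

lemma ptimeI:
  assumes "\<And>x. \<exists>t\<le>T x. computes_in P (encode x) (encode (f x)) t" "poly_in esize T"
    "poly_in esize (\<lambda>x. esize (f x))"
  shows "ptime f"
  using assms unfolding ptime_def by blast

subsection \<open>Linking programs\<close>

primrec shift :: "nat \<Rightarrow> exp \<Rightarrow> exp" where
  "shift k (EVar i) = EVar i"
| "shift k ELeaf = ELeaf"
| "shift k (ENode a b) = ENode (shift k a) (shift k b)"
| "shift k (ELeft a) = ELeft (shift k a)"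
| "shift k (ERight a) = ERight (shift k a)"
| "shift k (EIf a b c) = EIf (shift k a) (shift k b) (shift k c)"
| "shift k (ELet a b) = ELet (shift k a) (shift k b)"
| "shift k (ECall f es) = ECall (k + f) (map (shift k) es)"

definition link :: "program \<Rightarrow> program \<Rightarrow> program" where
  "link A P = A @ map (shift (length A)) P"

text \<open>\<open>B\<close> is any code linked in later. With it the lemma also covers a program
  that ends up in the middle.\<close>

lemma eval_shift:
  "eval P env e v t \<Longrightarrow> eval (link A P @ B) env (shift (length A) e) v t"
  "evals P env es vs t \<Longrightarrow> evals (link A P @ B) env (map (shift (length A)) es) vs t"
proof (induction rule: eval_evals.inducts)
  case (Call env es vs t1 f w t2)
  then have "(link A P @ B) ! (length A + f) = shift (length A) (P ! f)"
    by (simp add: link_def nth_append)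
  then show ?case
    unfolding shift.simps by (intro eval_evals.Call) (use Call in \<open>auto simp: link_def\<close>)
qed (auto intro: eval_evals.intros[simplified])

lemma computes_in_link:
  assumes "computes_in P x y t"
  shows "length A < length (link A P @ B)" "eval (link A P @ B) [x] ((link A P @ B) ! length A) y t"
  using assms eval_shift(1)[of P "[x]" "P ! 0" y t A B]
  by (auto simp: computes_in_def link_def nth_append)

lemma length_link [simp]: "length (link A P) = length A + length P"
  by (simp add: link_def)

lemma eval_Call1:
  "eval P env e x t1 \<Longrightarrow> f < length P \<Longrightarrow> eval P [x] (P ! f) w t2 \<Longrightarrow> eval P env (ECall f [e]) w (t1 + t2 + 1)"
  using eval_evals.Call[OF Cons[OF _ Nil], of P env e x t1] by simp

lemma eval_Var: "i < length env \<Longrightarrow> env ! i = v \<Longrightarrow> eval P env (EVar i) v (Suc 0)"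
  using Var[of i env P] by simp

lemma eval_Left: "eval P env e (Node a b) t \<Longrightarrow> eval P env (ELeft e) a (t + 1)"
  using Left[of P env e "Node a b"] by simp

lemma eval_Right: "eval P env e (Node a b) t \<Longrightarrow> eval P env (ERight e) b (t + 1)"
  using Right[of P env e "Node a b"] by simp

section \<open>Programs for the basic operations on trees\<close>

lemma ptime_prim':
  assumes "\<And>x. \<exists>t\<le>k. eval [e] [encode x] e (encode (f x)) t" and "poly_in esize (\<lambda>x. esize (f x))"
  shows "ptime f"
  by (rule ptimeI[where P = "[e]" and T = "\<lambda>_. k"]) (use assms in \<open>auto simp: computes_in_def intro: poly_intros\<close>)

lemma ptime_prim:
  assumes "\<And>x. eval [e] [encode x] e (encode (f x)) t" and "poly_in esize (\<lambda>x. esize (f x))"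
  shows "ptime f"
  using assms by (intro ptime_prim'[where k = t]) auto

lemma ptime_id: "ptime (\<lambda>x. x)"
  by (rule ptime_prim[where e = "EVar 0" and t = "Suc 0"]) (auto intro: eval_Var poly_intros)

text \<open>Stated for single runs, because it also has to compose the exponential-time search with
  its pre- and postprocessing.\<close>

lemma computes_in_comp:
  obtains R where "\<And>x y z t1 t2. computes_in PG x y t1 \<Longrightarrow> computes_in PF y z t2 \<Longrightarrow> computes_in R x z (t1 + t2 + 3)"
proof -
  \<comment> \<open>Glue code of one function: index 1 is the main function of \<open>PF\<close>,
    index \<open>1 + length PF\<close> that of \<open>PG\<close>.\<close>
  define A where "A = [ECall 1 [ECall (1 + length PF) [EVar 0]]]"
  define R where "R = link (link A PF) PG"
  have R: "R = link A PF @ map (shift (length (link A PF))) PG" "R = link (link A PF) PG @ []"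
    by (auto simp: R_def link_def)
  show thesis
  proof (rule that)
    fix x y z t1 t2 assume t: "computes_in PG x y t1" "computes_in PF y z t2"
    have f: "1 < length R" "eval R [y] (R ! 1) z t2"
      using computes_in_link[OF t(2), of A, folded R(1)] unfolding R(1) by (auto simp: A_def)
    have g: "1 + length PF < length R" "eval R [x] (R ! (1 + length PF)) y t1"
      using computes_in_link[OF t(1), of "link A PF" "[]", folded R(2)] by (auto simp: A_def)
    have main: "R ! 0 = ECall 1 [ECall (1 + length PF) [EVar 0]]" "R \<noteq> []"
      unfolding R_def by (auto simp: link_def A_def)
    have "eval R [x] (R ! 0) z ((Suc 0 + t1 + 1) + t2 + 1)"
      unfolding main(1) by (rule eval_Call1[OF eval_Call1[OF eval_Var g] f]) auto
    then show "computes_in R x z (t1 + t2 + 3)"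
      using main(2) by (simp add: computes_in_def numeral_3_eq_3)
  qed
qed

lemma ptime_comp:
  assumes "ptime f" "ptime g" shows "ptime (\<lambda>x. f (g x))"
proof -
  obtain PF c where F: "\<And>x. \<exists>t \<le> c * (esize x + 1) ^ c. computes_in PF (encode x) (encode (f x)) t"
    by (rule ptimeE[OF assms(1)]) (rule that)
  obtain PG d where G: "\<And>x. \<exists>t \<le> d * (esize x + 1) ^ d. computes_in PG (encode x) (encode (g x)) t"
    by (rule ptimeE[OF assms(2)]) (rule that)
  obtain R where R: "\<And>x y z t1 t2. computes_in PG x y t1 \<Longrightarrow> computes_in PF y z t2 \<Longrightarrow> computes_in R x z (t1 + t2 + 3)"
    by (rule computes_in_comp) (rule that)
  show ?thesis
  proof (rule ptimeI)
    fix x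
    obtain t2 where t2: "t2 \<le> d * (esize x + 1) ^ d" "computes_in PG (encode x) (encode (g x)) t2"
      using G by blast
    obtain t1 where t1: "t1 \<le> c * (esize (g x) + 1) ^ c" "computes_in PF (encode (g x)) (encode (f (g x))) t1"
      using F by blast
    show "\<exists>t\<le>d * (esize x + 1) ^ d + c * (esize (g x) + 1) ^ c + 3.
        computes_in R (encode x) (encode (f (g x))) t"
      using R[OF t2(2) t1(2)] t1(1) t2(1) by (intro exI[of _ "t2 + t1 + 3"]) auto
  next
    show "poly_in esize (\<lambda>x. d * (esize x + 1) ^ d + c * (esize (g x) + 1) ^ c + 3)"
      by (intro poly_intros ptime_size[OF assms(2)])
    show "poly_in esize (\<lambda>x. esize (f (g x)))"
      using poly_in_comp[OF ptime_size[OF assms(1)], of g] ptime_size[OF assms(2)] by (rule poly_in_trans)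
  qed
qed

lemma ptime_Pair:
  assumes "ptime f" "ptime g" shows "ptime (\<lambda>x. (f x, g x))"
proof -
  obtain PF c where F: "\<And>x. \<exists>t \<le> c * (esize x + 1) ^ c. computes_in PF (encode x) (encode (f x)) t"
    using ptimeE[OF assms(1)] by blast
  obtain PG d where G: "\<And>x. \<exists>t \<le> d * (esize x + 1) ^ d. computes_in PG (encode x) (encode (g x)) t"
    using ptimeE[OF assms(2)] by blast
  define A where "A = [ENode (ECall 1 [EVar 0]) (ECall (1 + length PF) [EVar 0])]"
  define R where "R = link (link A PF) PG"
  have R: "R = link A PF @ map (shift (length (link A PF))) PG" "R = link (link A PF) PG @ []"
    by (auto simp: R_def link_def)
  show ?thesis
  proof (rule ptimeI)
    fix x
    obtain t2 where t2: "t2 \<le> d * (esize x + 1) ^ d" "computes_in PG (encode x) (encode (g x)) t2"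
      using G by blast
    obtain t1 where t1: "t1 \<le> c * (esize x + 1) ^ c" "computes_in PF (encode x) (encode (f x)) t1"
      using F by blast
    have f: "1 < length R" "eval R [encode x] (R ! 1) (encode (f x)) t1"
      using computes_in_link[OF t1(2), of A, folded R(1)] unfolding R(1) by (auto simp: A_def)
    have g: "1 + length PF < length R" "eval R [encode x] (R ! (1 + length PF)) (encode (g x)) t2"
      using computes_in_link[OF t2(2), of "link A PF" "[]", folded R(2)] by (auto simp: A_def)
    have main: "R ! 0 = ENode (ECall 1 [EVar 0]) (ECall (1 + length PF) [EVar 0])" "R \<noteq> []"
      unfolding R_def by (auto simp: link_def A_def)
    have "eval R [encode x] (R ! 0) (encode (f x, g x)) ((Suc 0 + t1 + 1) + (Suc 0 + t2 + 1) + 1)"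
      unfolding main(1) encode_simps by (rule Node[OF eval_Call1[OF eval_Var f] eval_Call1[OF eval_Var g]]) auto
    then show "\<exists>t\<le>d * (esize x + 1) ^ d + c * (esize x + 1) ^ c + 5.
        computes_in R (encode x) (encode (f x, g x)) t"
      using t1(1) t2(1) main(2) unfolding computes_in_def
      by (intro exI[of _ "(1 + t1 + 1) + (1 + t2 + 1) + 1"]) auto
  next
    show "poly_in esize (\<lambda>x. d * (esize x + 1) ^ d + c * (esize x + 1) ^ c + 5)"
      by (intro poly_intros)
    show "poly_in esize (\<lambda>x. esize (f x, g x))"
      unfolding esize_prod fst_conv snd_conv
      by (intro poly_intros ptime_size[OF assms(1)] ptime_size[OF assms(2)])
  qed
qed

primrec econst :: "sexp \<Rightarrow> exp" where
  "econst Leaf = ELeaf"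
| "econst (Node a b) = ENode (econst a) (econst b)"

lemma eval_econst: "eval P env (econst v) v (2 * size v + 1)"
proof (induction v)
  case (Node a b)
  from eval_evals.Node[OF this] show ?case by (simp add: algebra_simps)
qed (auto intro: eval_evals.Leaf[simplified])

lemma ptime_const: "ptime (\<lambda>_. k)"
  by (rule ptime_prim[OF eval_econst]) (rule poly_intros)

text \<open>The condition and both branches are computed into a triple before one branch is
  selected. The waste is harmless, since \<open>ptime\<close> functions are total and
  polynomial.\<close>

lemma ptime_if:
  assumes "ptime b" "ptime f" "ptime g" shows "ptime (\<lambda>x. if b x then f x else g x)"
proof -
  have "ptime (\<lambda>p :: bool \<times> 'b \<times> 'b. if fst p then fst (snd p) else snd (snd p))"
  proof (rule ptime_prim)
    fix p :: "bool \<times> 'b \<times> 'b"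
    obtain b y z where p: "p = (b, y, z)" by (cases p) auto
    let ?e = "EIf (ELeft (EVar 0)) (ELeft (ERight (EVar 0))) (ERight (ERight (EVar 0)))"
    show "eval [?e] [encode p] ?e (encode (if fst p then fst (snd p) else snd (snd p))) ((Suc 0 + 1) + (Suc 0 + 1 + 1) + 1)"
    proof (cases b)
      case True
      have "eval [?e] [encode p] ?e (encode y) ((Suc 0 + 1) + (Suc 0 + 1 + 1) + 1)"
        by (rule IfTrue[OF eval_Left[OF eval_Var] _ eval_Left[OF eval_Right[OF eval_Var]]]) (use True p in auto)
      then show ?thesis using p True by simp
    next
      case False
      have "eval [?e] [encode p] ?e (encode z) ((Suc 0 + 1) + (Suc 0 + 1 + 1) + 1)"
        by (rule IfFalse[OF eval_Left[OF eval_Var] _ eval_Right[OF eval_Right[OF eval_Var]]]) (use False p in auto)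
      then show ?thesis using p False by simp
    qed
    show "poly_in esize (\<lambda>p :: bool \<times> 'b \<times> 'b. esize (if fst p then fst (snd p) else snd (snd p)))"
      by (rule poly_in_le[OF poly_in_self]) auto
  qed
  from ptime_comp[OF this ptime_Pair[OF assms(1) ptime_Pair[OF assms(2,3)]]] show ?thesis
    by (simp cong: if_cong)
qed

lemma ptime_fst: "ptime f \<Longrightarrow> ptime (\<lambda>x. fst (f x))"
proof (rule ptime_comp[where f = fst], rule ptime_prim)
  let ?e = "ELeft (EVar 0)"
  show "eval [?e] [encode x] ?e (encode (fst x)) (Suc 0 + 1)" for x :: "'b \<times> 'c"
    by (rule eval_Left, rule eval_Var[where v = "Node (encode (fst x)) (encode (snd x))"]) (auto simp: encode_prod_def)
  show "poly_in esize (\<lambda>x :: 'b \<times> 'c. esize (fst x))"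
    by (rule poly_in_le[OF poly_in_self]) auto
qed

lemma ptime_snd: "ptime f \<Longrightarrow> ptime (\<lambda>x. snd (f x))"
proof (rule ptime_comp[where f = snd], rule ptime_prim)
  let ?e = "ERight (EVar 0)"
  show "eval [?e] [encode x] ?e (encode (snd x)) (Suc 0 + 1)" for x :: "'b \<times> 'c"
    by (rule eval_Right, rule eval_Var[where v = "Node (encode (fst x)) (encode (snd x))"]) (auto simp: encode_prod_def)
  show "poly_in esize (\<lambda>x :: 'b \<times> 'c. esize (snd x))"
    by (rule poly_in_le[OF poly_in_self]) auto
qed

text \<open>A pair and a list cell have the same code, so after pairing the program is the identity.
  The same works for the successor, as \<open>Suc n\<close> is coded like the pair
  \<open>((), n)\<close>.\<close>

lemma ptime_Cons:
  assumes "ptime f" "ptime g" shows "ptime (\<lambda>x. f x # g x)"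
proof -
  have "ptime (\<lambda>p :: 'b \<times> 'b list. fst p # snd p)"
    by (rule ptime_prim[where e = "EVar 0" and t = "Suc 0"])
       (auto intro!: eval_Var simp: encode_prod_def esize_prod intro: poly_intros)
  from ptime_comp[OF this ptime_Pair[OF assms]] show ?thesis by simp
qed

lemma ptime_Suc: 
  assumes "ptime f" shows "ptime (\<lambda>x. Suc (f x))"
proof -
  have "ptime (\<lambda>p :: unit \<times> nat. Suc (snd p))"
    by (rule ptime_prim[where e = "EVar 0" and t = "Suc 0"])
       (auto intro!: eval_Var simp: encode_prod_def esize_prod intro: poly_intros
         poly_in_le[OF poly_in_self])
  from ptime_comp[OF this ptime_Pair[OF ptime_const[of "()"] assms]] show ?thesis by simp
qed

lemma encode_tl: "encode (tl xs) = right (encode xs)"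
  by (cases xs) auto

lemma size_right_le: "size (right v) \<le> size v"
  by (cases v) simp_all

lemma ptime_right:
  assumes "\<And>x. encode (f x) = right (encode x)" shows "ptime f"
proof (rule ptime_prim)
  show "eval [ERight (EVar 0)] [encode x] (ERight (EVar 0)) (encode (f x)) (Suc 0 + 1)" for x
    unfolding assms by (rule Right[OF eval_Var]) auto
  show "poly_in esize (\<lambda>x. esize (f x))"
    unfolding assms by (rule poly_in_le[OF poly_in_self size_right_le])
qed

lemma ptime_tl: "ptime f \<Longrightarrow> ptime (\<lambda>x. tl (f x))"
  by (rule ptime_comp[OF ptime_right[OF encode_tl]])

lemma ptime_replicate: "ptime (\<lambda>n. replicate n ())"
proof (rule ptime_prim[where e = "EVar 0" and t = "Suc 0"])
  have *: "encode (replicate n ()) = encode n" for n by (induction n) auto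
  show "eval [EVar 0] [encode n] (EVar 0) (encode (replicate n ())) (Suc 0)" for n
    by (simp add: * eval_Var)
  show "poly_in esize (\<lambda>n. esize (replicate n ()))"
    unfolding * by (rule poly_intros)
qed

lemma ptime_Nil_eq:
  assumes "ptime f" shows "ptime (\<lambda>x. f x = [])"
proof -
  have "ptime (\<lambda>xs :: 'b list. xs = [])"
  proof (rule ptime_prim'[where k = 5])
    let ?e = "EIf (EVar 0) ELeaf (ENode ELeaf ELeaf)"
    fix xs :: "'b list"
    show "poly_in esize (\<lambda>xs :: 'b list. esize (xs = []))"
      by (rule poly_in_le[OF poly_in_const[of _ 1]]) (auto simp: encode_bool_def enc_bool_def)
    show "\<exists>t\<le>5. eval [?e] [encode xs] ?e (encode (xs = [])) t"
    proof (cases xs)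
      case Nil
      have "eval [?e] [encode xs] ?e (encode (xs = [])) (Suc 0 + (1 + 1 + 1) + 1)"
        unfolding Nil encode_simps simp_thms
        by (rule IfFalse[OF eval_Var _ eval_evals.Node[OF eval_evals.Leaf eval_evals.Leaf]]) auto
      then show ?thesis by (intro exI[of _ 5]) (simp add: numeral_eq_Suc)
    next
      case (Cons y ys)
      have "eval [?e] [encode xs] ?e Leaf (Suc 0 + 1 + 1)"
        by (rule IfTrue[OF eval_Var _ eval_evals.Leaf]) (auto simp: Cons)
      then show ?thesis by (intro exI[of _ 3]) (simp add: numeral_eq_Suc Cons)
    qed
  qed
  from ptime_comp[OF this assms] show ?thesis by simp
qed

lemma ptime_hd:
  assumes "ptime f" shows "ptime (\<lambda>x. hd (f x))"
proof -
  have "ptime (\<lambda>xs :: 'b list. hd xs)"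
  proof (rule ptime_prim')
    \<comment> \<open>\<open>hd []\<close> is unspecified but fixed, so its code can be built into
      the program as a constant.\<close>
    let ?e = "EIf (EVar 0) (ELeft (EVar 0)) (econst (encode (hd [] :: 'b)))"
    let ?k = "2 * esize (hd [] :: 'b) + 5"
    fix xs :: "'b list"
    show "poly_in esize (\<lambda>xs :: 'b list. esize (hd xs))"
    proof (rule poly_in_le)
      show "poly_in esize (\<lambda>xs :: 'b list. esize xs + esize (hd [] :: 'b))"
        by (intro poly_intros)
      show "esize (hd xs) \<le> esize xs + esize (hd [] :: 'b)" for xs :: "'b list"
        by (cases xs) auto
    qed
    show "\<exists>t\<le>?k. eval [?e] [encode xs] ?e (encode (hd xs)) t"
    proof (cases xs)
      case Nil
      have "eval [?e] [encode xs] ?e (encode (hd xs)) (Suc 0 + (2 * esize (hd [] :: 'b) + 1) + 1)"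
        unfolding Nil by (rule IfFalse[OF eval_Var _ eval_econst]) auto
      then show ?thesis by (intro exI[of _ "Suc 0 + (2 * esize (hd [] :: 'b) + 1) + 1"]) auto
    next
      case (Cons y ys)
      have "eval [?e] [encode xs] ?e (encode (hd xs)) (Suc 0 + (Suc 0 + 1) + 1)"
        by (rule IfTrue[OF eval_Var _ eval_Left[OF eval_Var]]) (auto simp: Cons)
      then show ?thesis by (intro exI[of _ "Suc 0 + (Suc 0 + 1) + 1"]) auto
    qed
  qed
  from ptime_comp[OF this assms] show ?thesis by simp
qed

section \<open>List recursion and the operations derived from it\<close>

lemma ptime_rec_list:
  assumes z: "ptime z" and g: "ptime (\<lambda>p. g (fst p) (fst (snd p)) (fst (snd (snd p))) (snd (snd (snd p))))"
    and size: "poly_in esize (\<lambda>p. esize (rec_list (z (fst p)) (g (fst p)) (snd p)))"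
  shows "ptime (\<lambda>p. rec_list (z (fst p)) (g (fst p)) (snd p))"
proof -
  obtain PZ c where Z: "\<And>x. \<exists>t \<le> c * (esize x + 1) ^ c. computes_in PZ (encode x) (encode (z x)) t"
    by (rule ptimeE[OF z]) (rule that)
  obtain PG d where G: "\<And>p. \<exists>t \<le> d * (esize p + 1) ^ d. computes_in PG (encode p)
      (encode (g (fst p) (fst (snd p)) (fst (snd (snd p))) (snd (snd (snd p))))) t"
    by (rule ptimeE[OF g]) (rule that)
  obtain b where b: "\<And>x es. esize (rec_list (z x) (g x) es) \<le> b * (esize (x, es) + 1) ^ b"
  proof -
    from size obtain b where b: "\<forall>p. esize (rec_list (z (fst p)) (g (fst p)) (snd p)) \<le> b * (esize p + 1) ^ b"
      unfolding poly_in_def ..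
    have "esize (rec_list (z x) (g x) es) \<le> b * (esize (x, es) + 1) ^ b" for x es
      using b[rule_format, of "(x, es)"] by simp
    then show thesis by (rule that)
  qed
  let ?arg = "ELeft (EVar 0)" and ?xs = "ERight (EVar 0)"
  \<comment> \<open>Function 0 calls itself on the tail and then applies \<open>PG\<close> to the
    context, head, tail and recursive result. The context travels along because functions see
    nothing but their arguments.\<close>
  define main where "main = EIf ?xs
    (ECall (1 + length PZ) [ENode ?arg (ENode (ELeft ?xs) (ENode (ERight ?xs) (ECall 0 [ENode ?arg (ERight ?xs)])))])
    (ECall 1 [?arg])"
  define R where "R = link (link [main] PZ) PG"
  have R: "R = link [main] PZ @ map (shift (length (link [main] PZ))) PG" "R = link (link [main] PZ) PG @ []"
    by (auto simp: R_def link_def)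
  have R0: "R ! 0 = main" "R \<noteq> []" by (auto simp: R_def link_def)
  \<comment> \<open>\<open>B\<close> bounds every intermediate result and \<open>H\<close> the time
    of one round. The bound \<open>B\<close> rests on the assumption \<open>size\<close>: a round
    that doubled its result would lead to exponential growth. \<open>N\<close> stays fixed during
    the induction.\<close>
  define B where "B N = b * (N + 1) ^ b" for N
  define H where "H N = d * ((2 * N + B N + 3) + 1) ^ d + 30" for N
  have time: "\<exists>t \<le> c * (N + 1) ^ c + 10 + length es * H N.
      eval R [encode (x, es)] main (encode (rec_list (z x) (g x) es)) t"
    if "esize (x, es) \<le> N" for x es N
    using that
  proof (induction es)
    case Nil
    obtain t where t: "t \<le> c * (esize x + 1) ^ c" "computes_in PZ (encode x) (encode (z x)) t"
      using Z by blast
    have f: "1 < length R" "eval R [encode x] (R ! 1) (encode (z x)) t"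
      using computes_in_link[OF t(2), of "[main]", folded R(1)] unfolding R(1) by auto
    have "eval R [encode (x, [] :: 'c list)] main (encode (z x)) ((Suc 0 + 1) + ((Suc 0 + 1) + t + 1) + 1)"
      unfolding main_def
      by (rule IfFalse[OF eval_Right[OF eval_Var] _ eval_Call1[OF eval_Left[OF eval_Var] f]]) auto
    moreover have "t \<le> c * (N + 1) ^ c"
      using t(1) by (rule order_trans) (use Nil in \<open>auto intro!: mult_le_mono power_mono\<close>)
    ultimately show ?case
      by (intro exI[of _ "(Suc 0 + 1) + ((Suc 0 + 1) + t + 1) + 1"]) auto
  next
    case (Cons e es)
    define r where "r = rec_list (z x) (g x) es"
    obtain s where s: "s \<le> c * (N + 1) ^ c + 10 + length es * H N"
      "eval R [encode (x, es)] (R ! 0) (encode r) s"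
      using Cons by (auto simp: r_def R0)
    obtain t where t: "t \<le> d * (esize (x, e, es, r) + 1) ^ d" "computes_in PG (encode (x, e, es, r)) (encode (g x e es r)) t"
      using G[of "(x, e, es, r)"] by auto
    have f: "1 + length PZ < length R" "eval R [encode (x, e, es, r)] (R ! (1 + length PZ)) (encode (g x e es r)) t"
      using computes_in_link[OF t(2), of "link [main] PZ" "[]", folded R(2)] by auto
    have env: "eval R [encode (x, e # es)] (EVar 0) (Node (encode x) (Node (encode e) (encode es))) (Suc 0)"
      by (rule eval_Var) auto
    note c = eval_Call1[OF Node[OF eval_Left[OF env] eval_Right[OF eval_Right[OF env]]] _ s(2)[unfolded encode_simps]]
    note d = eval_Call1[OF Node[OF eval_Left[OF env] Node[OF eval_Left[OF eval_Right[OF env]]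
      Node[OF eval_Right[OF eval_Right[OF env]] c]]] f[unfolded encode_simps]]
    have "\<exists>u. u \<le> t + s + 30 \<and> eval R [encode (x, e # es)] main (encode (g x e es r)) u"
      unfolding main_def
      by (rule exI, rule conjI[rotated], rule IfTrue[OF eval_Right[OF env] _ d]) (use R0(2) in auto)
    then obtain u where u: "u \<le> t + s + 30" "eval R [encode (x, e # es)] main (encode (g x e es r)) u"
      by blast
    have "esize r \<le> B N"
      unfolding B_def r_def by (rule order_trans[OF b]) (use Cons.prems in \<open>auto intro!: mult_le_mono power_mono\<close>)
    then have "esize (x, e, es, r) + 1 \<le> (2 * N + B N + 3) + 1"
      using Cons.prems by simp
    then have "t + 30 \<le> H N"
      unfolding H_def using t(1) by (meson add_le_mono1 mult_le_mono2 order_trans power_mono zero_le)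
    with u(1) s(1) have "u \<le> c * (N + 1) ^ c + 10 + length (e # es) * H N" by simp
    with u(2) show ?case by (auto simp: r_def)
  qed
  show ?thesis
  proof (rule ptimeI)
    fix p :: "'a \<times> 'c list"
    show "\<exists>t\<le>c * (esize p + 1) ^ c + 10 + esize p * H (esize p).
      computes_in R (encode p) (encode (rec_list (z (fst p)) (g (fst p)) (snd p))) t"
    proof -
      obtain t where t: "t \<le> c * (esize p + 1) ^ c + 10 + length (snd p) * H (esize p)"
        "eval R [encode p] main (encode (rec_list (z (fst p)) (g (fst p)) (snd p))) t"
        using time[of "fst p" "snd p" "esize p"] by auto
      have "length (snd p) \<le> esize p"
        using length_le_esize[of "snd p"] by (simp add: esize_prod)
      then have "length (snd p) * H (esize p) \<le> esize p * H (esize p)" by simp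
      with t(1) have "t \<le> c * (esize p + 1) ^ c + 10 + esize p * H (esize p)" by linarith
      with t(2) show ?thesis unfolding computes_in_def using R0 by auto
    qed
    show "poly_in esize (\<lambda>p :: 'a \<times> 'c list. c * (esize p + 1) ^ c + 10 + esize p * H (esize p))"
      unfolding H_def B_def by (intro poly_intros)
    show "poly_in esize (\<lambda>p. esize (rec_list (z (fst p)) (g (fst p)) (snd p)))"
      by (fact size)
  qed
qed

lemma ptime_fold:
  assumes "ptime xs" "ptime z" "ptime (\<lambda>p. g (fst p) (fst (snd p)) (fst (snd (snd p))) (snd (snd (snd p))))"
    and "poly_in esize (\<lambda>p. esize (rec_list (z (fst p)) (g (fst p)) (snd p)))"
  shows "ptime (\<lambda>x. rec_list (z x) (g x) (xs x))"
  using ptime_comp[OF ptime_rec_list[OF assms(2-4)] ptime_Pair[OF ptime_id assms(1)]] by simp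

lemma ptime_map:
  assumes xs: "ptime xs" and f: "ptime (\<lambda>p. f (fst p) (snd p))"
  shows "ptime (\<lambda>x. map (f x) (xs x))"
proof -
  have eq: "map (f x) es = rec_list [] (\<lambda>e es r. f x e # r) es" for x es
    by (induction es) auto
  obtain c where c: "\<And>x e. esize (f x e) \<le> c * (esize (x, e) + 1) ^ c"
  proof -
    from ptime_size[OF f] obtain c where c: "\<forall>p. esize (f (fst p) (snd p)) \<le> c * (esize p + 1) ^ c"
      unfolding poly_in_def ..
    have "esize (f x e) \<le> c * (esize (x, e) + 1) ^ c" for x e
      using c[rule_format, of "(x, e)"] by simp
    then show thesis by (rule that)
  qed
  have "esize (map (f (fst p)) (snd p)) \<le> esize p * (c * (esize p + 1) ^ c + 1)" for p
  proof (rule esize_list_le)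
    fix y assume "y \<in> set (map (f (fst p)) (snd p))"
    then obtain e where e: "e \<in> set (snd p)" "y = f (fst p) e" by auto
    show "esize y \<le> c * (esize p + 1) ^ c"
      unfolding e(2) using esize_mem[OF e(1)]
      by (intro order_trans[OF c] mult_le_mono2 power_mono) (auto simp: esize_prod)
  next
    show "length (map (f (fst p)) (snd p)) \<le> esize p"
      using length_le_esize[of "snd p"] by (simp add: esize_prod)
  qed
  then have "poly_in esize (\<lambda>p. esize (map (f (fst p)) (snd p)))"
    by (rule poly_in_le[rotated]) (intro poly_intros)
  moreover have "ptime (\<lambda>p. f (fst p) (fst (snd p)))"
    using ptime_comp[OF f ptime_Pair[OF ptime_fst[OF ptime_id] ptime_fst[OF ptime_snd[OF ptime_id]]]] by simp
  ultimately show ?thesis unfolding eq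
    by (intro ptime_fold xs ptime_const ptime_Cons ptime_snd ptime_id)
qed

lemma ptime_filter:
  assumes xs: "ptime xs" and f: "ptime (\<lambda>p. R (fst p) (snd p))"
  shows "ptime (\<lambda>x. filter (R x) (xs x))"
proof -
  have eq: "filter (R x) es = rec_list [] (\<lambda>e es r. if R x e then e # r else r) es" for x es
    by (induction es) auto
  have "esize (filter (R (fst p)) (snd p)) \<le> esize p" for p
  proof -
    have "esize (filter (R (fst p)) es) \<le> esize es" for es by (induction es) auto
    from this[of "snd p"] show ?thesis by (simp add: esize_prod)
  qed
  then have "poly_in esize (\<lambda>p. esize (filter (R (fst p)) (snd p)))"
    by (rule poly_in_le[OF poly_in_self])
  moreover have "ptime (\<lambda>p. R (fst p) (fst (snd p)))"
    using ptime_comp[OF f ptime_Pair[OF ptime_fst[OF ptime_id] ptime_fst[OF ptime_snd[OF ptime_id]]]] by simp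
  ultimately show ?thesis unfolding eq
    by (intro ptime_fold xs ptime_const ptime_Cons ptime_snd ptime_fst ptime_id ptime_if)
qed

lemma ptime_not:
  assumes "ptime a" shows "ptime (\<lambda>x. \<not> a x)"
proof -
  have "(\<lambda>x. \<not> a x) = (\<lambda>x. if a x then False else True)" by auto
  then show ?thesis using ptime_if[OF assms ptime_const[of False] ptime_const[of True]] by simp
qed

lemma ptime_conj:
  assumes "ptime a" "ptime b" shows "ptime (\<lambda>x. a x \<and> b x)"
proof -
  have "(\<lambda>x. a x \<and> b x) = (\<lambda>x. if a x then b x else False)" by auto
  then show ?thesis using ptime_if[OF assms ptime_const[of False]] by simp
qed

lemma ptime_disj:
  assumes "ptime a" "ptime b" shows "ptime (\<lambda>x. a x \<or> b x)"
  using ptime_not[OF ptime_conj[OF ptime_not[OF assms(1)] ptime_not[OF assms(2)]]] by simp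

lemma ptime_imp:
  assumes "ptime a" "ptime b" shows "ptime (\<lambda>x. a x \<longrightarrow> b x)"
  using ptime_disj[OF ptime_not[OF assms(1)] assms(2)] by (simp only: imp_conv_disj)

lemma ptime_ex:
  assumes "ptime xs" "ptime (\<lambda>p. R (fst p) (snd p))"
  shows "ptime (\<lambda>x. \<exists>e\<in>set (xs x). R x e)"
  using ptime_not[OF ptime_Nil_eq[OF ptime_filter[OF assms]]] by (simp add: filter_empty_conv)

lemma ptime_all:
  assumes "ptime xs" "ptime (\<lambda>p. R (fst p) (snd p))"
  shows "ptime (\<lambda>x. \<forall>e\<in>set (xs x). R x e)"
  using ptime_not[OF ptime_ex[OF assms(1) ptime_not[OF assms(2)]]] by simp

lemma ptime_append:
  assumes "ptime f" "ptime g" shows "ptime (\<lambda>x. f x @ g x)"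
proof -
  have eq: "es @ y = rec_list y (\<lambda>e es r. e # r) es" for es y :: "'b list"
    by (induction es) auto
  have "ptime (\<lambda>p :: 'b list \<times> 'b list. snd p @ fst p)"
    unfolding eq
  proof (intro ptime_fold ptime_snd ptime_fst ptime_id ptime_Cons)
    show "poly_in esize (\<lambda>p :: ('b list \<times> 'b list) \<times> 'b list. esize (rec_list (fst (fst p)) (\<lambda>e es r. e # r) (snd p)))"
      unfolding eq[symmetric] by (rule poly_in_le[OF poly_in_self]) (simp add: esize_list esize_prod)
  qed
  from ptime_comp[OF this ptime_Pair[OF assms(2,1)]] show ?thesis by simp
qed

lemma ptime_concat:
  assumes "ptime f" shows "ptime (\<lambda>x. concat (f x))"
proof -
  have eq: "concat es = rec_list [] (\<lambda>e es r. e @ r) es" for es :: "'b list list"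
    by (induction es) auto
  have le: "esize (concat es) \<le> esize es" for es :: "'b list list"
    by (induction es) (auto simp: esize_list)
  show ?thesis unfolding eq
  proof (intro ptime_fold ptime_snd ptime_fst ptime_id ptime_append assms ptime_const)
    show "poly_in esize (\<lambda>p :: 'a \<times> 'b list list. esize (rec_list [] (\<lambda>e es r. e @ r) (snd p)))"
      unfolding eq[symmetric]
    proof (rule poly_in_le[OF poly_in_self])
      show "esize (concat (snd p)) \<le> esize p" for p :: "'a \<times> 'b list list"
        using le[of "snd p"] by (simp add: esize_prod)
    qed
  qed
qed

lemma ptime_length:
  assumes "ptime f" shows "ptime (\<lambda>x. length (f x))"
proof -
  have eq: "length es = rec_list 0 (\<lambda>e es r. Suc r) es" for es :: "'b list"
    by (induction es) auto
  show ?thesis unfolding eq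
  proof (intro ptime_fold ptime_snd ptime_fst ptime_id ptime_Suc assms ptime_const)
    show "poly_in esize (\<lambda>p :: 'a \<times> 'b list. esize (rec_list (0 :: nat) (\<lambda>e es r. Suc r) (snd p)))"
      unfolding eq[symmetric]
    proof (rule poly_in_le[OF poly_in_self])
      show "esize (length (snd p)) \<le> esize p" for p :: "'a \<times> 'b list"
        using length_le_esize[of "snd p"] by (simp add: esize_prod)
    qed
  qed
qed

text \<open>The counter is turned into a list of units, and recursion over this list applies
  \<open>tl\<close> once per unit.\<close>

lemma ptime_drop:
  assumes "ptime k" "ptime f" shows "ptime (\<lambda>x. drop (k x) (f x))"
proof -
  have eq': "rec_list ys (\<lambda>e es r. tl r) us = drop (length us) ys" for us :: "unit list" and ys :: "'b list"
    by (induction us) (auto simp: drop_Suc tl_drop)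
  have eq: "drop k ys = rec_list ys (\<lambda>e es r. tl r) (replicate k ())" for k and ys :: "'b list"
    unfolding eq' by simp
  have le: "esize (drop k ys) \<le> esize ys" for k and ys :: "'b list"
    by (induction ys arbitrary: k) (auto simp: drop_Cons' intro: le_SucI trans_le_add2)
  have "ptime (\<lambda>p :: 'b list \<times> nat. drop (snd p) (fst p))"
    unfolding eq
  proof (intro ptime_fold ptime_snd ptime_fst ptime_id ptime_tl ptime_comp[OF ptime_replicate])
    show "poly_in esize (\<lambda>p :: ('b list \<times> nat) \<times> unit list. esize (rec_list (fst (fst p)) (\<lambda>e es r. tl r) (snd p)))"
      unfolding eq'
    proof (rule poly_in_le[OF poly_in_self])
      show "esize (drop (length (snd p)) (fst (fst p))) \<le> esize p" for p :: "('b list \<times> nat) \<times> unit list"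
        using le[of "length (snd p)" "fst (fst p)"] by (simp add: esize_prod)
    qed
  qed
  from ptime_comp[OF this ptime_Pair[OF assms(2,1)]] show ?thesis by simp
qed

lemma ptime_less:
  assumes "ptime f" "ptime g" shows "ptime (\<lambda>x. f x < (g x :: nat))"
proof -
  have "(\<lambda>x. f x < g x) = (\<lambda>x. drop (f x) (replicate (g x) ()) \<noteq> [])" by auto
  then show ?thesis
    by (simp only: ptime_not[OF ptime_Nil_eq[OF ptime_drop[OF assms(1) ptime_comp[OF ptime_replicate assms(2)]]]])
qed

lemma ptime_le:
  assumes "ptime f" "ptime g" shows "ptime (\<lambda>x. f x \<le> (g x :: nat))"
  using ptime_not[OF ptime_less[OF assms(2,1)]] by (simp add: not_less)

lemma ptime_eq:
  assumes "ptime f" "ptime g" shows "ptime (\<lambda>x. f x = (g x :: nat))"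
  using ptime_conj[OF ptime_le[OF assms] ptime_le[OF assms(2,1)]] by (simp add: eq_iff)

lemma ptime_upt:
  assumes "ptime f" shows "ptime (\<lambda>x. [0..<f x])"
proof -
  have eq': "rec_list [] (\<lambda>e es r. r @ [length r]) us = [0..<length us]" for us :: "unit list"
    by (induction us) auto
  have eq: "[0..<k] = rec_list [] (\<lambda>e es r. r @ [length r]) (replicate k ())" for k
    unfolding eq' by simp
  have "ptime (\<lambda>k. [0..<k])"
    unfolding eq
  proof (intro ptime_fold ptime_snd ptime_fst ptime_id ptime_append ptime_Cons ptime_length ptime_const ptime_comp[OF ptime_replicate])
    show "poly_in esize (\<lambda>p :: nat \<times> unit list. esize (rec_list [] (\<lambda>e es r. r @ [length r]) (snd p)))"
      unfolding eq'
    proof (rule poly_in_le)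
      show "poly_in esize (\<lambda>p :: nat \<times> unit list. esize p * (esize p + 1))"
        by (intro poly_intros)
      show "esize [0..<length (snd p)] \<le> esize p * (esize p + 1)" for p :: "nat \<times> unit list"
        using length_le_esize[of "snd p"] by (intro esize_list_le) (auto simp: esize_prod)
    qed
  qed
  from ptime_comp[OF this assms] show ?thesis .
qed

named_theorems ptime_intros
lemmas [ptime_intros] = ptime_id ptime_Pair ptime_fst ptime_snd ptime_const ptime_if ptime_Cons ptime_Suc
  ptime_tl ptime_hd ptime_Nil_eq ptime_map ptime_filter ptime_not ptime_conj ptime_disj ptime_imp
  ptime_ex ptime_all ptime_append ptime_concat ptime_length ptime_drop ptime_less ptime_le ptime_eq ptime_upt

section \<open>The branching step\<close>

type_synonym inst = "bool list list \<times> bool list"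
text \<open>
  An entry \<open>(v, 0)\<close> of a state says that \<open>v\<close> is deleted, an entry \<open>(v, Suc c)\<close> that
  \<open>v\<close> gets colour \<open>c\<close>.
\<close>

type_synonym state = "(nat \<times> nat) list"

text \<open>Entries are read by \<open>hd\<close> and \<open>drop\<close> because these have
  \<open>ptime\<close> rules. The length tests keep out the unspecified
  \<open>hd []\<close>.\<close>

definition adj :: "inst \<Rightarrow> nat \<Rightarrow> nat \<Rightarrow> bool" where
  "adj I u v \<longleftrightarrow> u < length (fst I) \<and> v < length (hd (drop u (fst I))) \<and> hd (drop v (hd (drop u (fst I))))"

definition in_hub :: "inst \<Rightarrow> nat \<Rightarrow> bool" where
  "in_hub I v \<longleftrightarrow> v < length (snd I) \<and> hd (drop v (snd I))"

definition vertices :: "inst \<Rightarrow> nat list" where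
  "vertices I = [0..<length (fst I)]"

definition assigned :: "state \<Rightarrow> nat \<Rightarrow> bool" where
  "assigned B u \<longleftrightarrow> (\<exists>e\<in>set B. fst e = u)"

definition valid :: "inst \<Rightarrow> state \<Rightarrow> bool" where
  "valid I B \<longleftrightarrow> (\<forall>e\<in>set B. \<forall>e'\<in>set B.
     adj I (fst e) (fst e') \<longrightarrow> snd e = 0 \<or> snd e' = 0 \<or> \<not> snd e = snd e')"

text \<open>
  A deleted hub vertex costs \<open>n\<close>, any other deleted vertex \<open>n + 1\<close>: the cheapest solutions are those
  of minimum cardinality that delete as many hub vertices as possible.
\<close>

definition cost :: "inst \<Rightarrow> state \<Rightarrow> nat" where
  "cost I B = length (concat (map (\<lambda>e. if \<not> snd e = 0 then [] else
     if in_hub I (fst e) then vertices I else 0 # vertices I) B))"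

text \<open>Assigned vertices are skipped, so repetitions in a list of vertices and overlaps with
  the given state are harmless. The \<open>Suc q\<close> choices are deletion and the
  \<open>q\<close> colours.\<close>

definition extend_at :: "nat \<Rightarrow> nat \<Rightarrow> state list \<Rightarrow> state list" where
  "extend_at q u L = concat (map (\<lambda>B. if assigned B u then [B] else map (\<lambda>c. (u, c) # B) [0..<Suc q]) L)"

definition extensions :: "nat \<Rightarrow> nat list \<Rightarrow> state \<Rightarrow> state list" where
  "extensions q W A = foldr (extend_at q) W [A]"

text \<open>No edge from \<open>u\<close> leaves the domain of \<open>B\<close>, so changing the
  value of \<open>u\<close> can only create conflicts that \<open>valid\<close> detects.\<close>

definition enclosed :: "inst \<Rightarrow> state \<Rightarrow> nat \<Rightarrow> bool" where
  "enclosed I B u \<longleftrightarrow> (\<forall>v\<in>set (vertices I). adj I u v \<longrightarrow> assigned B v)"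

text \<open>
  If \<open>safe I B' B\<close> and \<open>B'\<close> is valid on the same domain, then replacing \<open>B\<close> by \<open>B'\<close> in any
  completion of \<open>B\<close> creates no conflict with the vertices outside the domain.
\<close>

definition safe :: "inst \<Rightarrow> state \<Rightarrow> state \<Rightarrow> bool" where
  "safe I B' B \<longleftrightarrow> (\<forall>e\<in>set B'. snd e = 0 \<or> (\<exists>e'\<in>set B. fst e' = fst e \<and> snd e' = snd e) \<or> enclosed I B (fst e))"

text \<open>
  Among equally cheap states that are safe for each other only the last one in the list survives.
  This makes the surviving states on a closed set unique once their hub part is fixed.
\<close>

primrec keep :: "inst \<Rightarrow> state list \<Rightarrow> state list \<Rightarrow> state list" where
  "keep I L [] = []"
| "keep I L (B # M) = (if (\<forall>B'\<in>set L. \<not> (safe I B' B \<and> cost I B' < cost I B)) \<and>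
     (\<forall>B'\<in>set M. \<not> (safe I B' B \<and> cost I B' \<le> cost I B)) then B # keep I L M else keep I L M)"

definition children :: "nat \<Rightarrow> inst \<Rightarrow> nat list \<Rightarrow> state \<Rightarrow> state list" where
  "children q I W A = keep I (filter (valid I) (extensions q W A)) (filter (valid I) (extensions q W A))"

text \<open>The first condition guarantees a fresh vertex, hence progress. The second one lets the
  \<open>k\<close> free hub vertices of \<open>W\<close> pay for the branching: the list compared
  with has length \<open>(q + 1) ^ k\<close>, and a single child costs nothing even if
  \<open>k = 0\<close>.\<close>

definition reducible :: "nat \<Rightarrow> inst \<Rightarrow> state \<Rightarrow> nat list \<Rightarrow> bool" where
  "reducible q I A W \<longleftrightarrow> 1 < length (extensions q W A) \<and>
     (length (children q I W A) \<le> 1 \<or>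
      length (children q I W A) < length (extensions q (filter (in_hub I) W) A))"

text \<open>For fixed \<open>k\<close> these are only polynomially many lists.\<close>

primrec words :: "nat \<Rightarrow> nat list \<Rightarrow> nat list list" where
  "words 0 V = [[]]"
| "words (Suc k) V = [] # concat (map (\<lambda>W. map (\<lambda>v. v # W) V) (words k V))"

text \<open>Value \<open>1\<close> is the first colour, as \<open>0\<close> stands for deletion.
  Only one hub vertex is coloured per step; then reducibility is tested afresh.\<close>

definition branch :: "nat \<Rightarrow> nat \<Rightarrow> inst \<Rightarrow> state \<Rightarrow> state list" where
  "branch q w I A = (let Ws = filter (reducible q I A) (words w (vertices I));
       U = filter (\<lambda>v. in_hub I v \<and> \<not> assigned A v) (vertices I)
     in if \<not> Ws = [] then children q I (hd Ws) A
        else if \<not> U = [] then [(hd U, 1) # A] else [])"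

section \<open>Polynomial-time computability of the branching step\<close>

lemma ptime_adj:
  assumes "ptime i" "ptime u" "ptime v" shows "ptime (\<lambda>x. adj (i x) (u x) (v x))"
  unfolding adj_def by (intro ptime_intros assms)

lemma ptime_in_hub:
  assumes "ptime i" "ptime u" shows "ptime (\<lambda>x. in_hub (i x) (u x))"
  unfolding in_hub_def by (intro ptime_intros assms)

lemma ptime_vertices:
  assumes "ptime i" shows "ptime (\<lambda>x. vertices (i x))"
  unfolding vertices_def by (intro ptime_intros assms)

lemma ptime_assigned:
  assumes "ptime b" "ptime u" shows "ptime (\<lambda>x. assigned (b x) (u x))"
  unfolding assigned_def by (intro ptime_intros assms assms[THEN ptime_comp])

lemma ptime_valid:
  assumes "ptime i" "ptime b" shows "ptime (\<lambda>x. valid (i x) (b x))"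
  unfolding valid_def by (intro ptime_intros ptime_adj assms assms[THEN ptime_comp])

lemma ptime_cost:
  assumes "ptime i" "ptime b" shows "ptime (\<lambda>x. cost (i x) (b x))"
  unfolding cost_def by (intro ptime_intros ptime_in_hub ptime_vertices assms assms[THEN ptime_comp])

lemma ptime_safe:
  assumes "ptime i" "ptime b" "ptime b'" shows "ptime (\<lambda>x. safe (i x) (b x) (b' x))"
  unfolding safe_def enclosed_def
  by (intro ptime_intros ptime_adj ptime_vertices ptime_assigned assms assms[THEN ptime_comp])

lemma ptime_extend_at:
  assumes "ptime u" "ptime l" shows "ptime (\<lambda>x. extend_at q (u x) (l x))"
  unfolding extend_at_def
  by (intro ptime_intros ptime_assigned assms assms[THEN ptime_comp])

text \<open>The number of extensions is exponential in the number of fresh vertices, so the list has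
  to be of bounded length, which \<open>take k\<close> enforces. The recursion on the constant
  \<open>k\<close> unrolls into a composition of \<open>k\<close> steps.\<close>

lemma ptime_extensions:
  assumes "ptime W" "ptime a" shows "ptime (\<lambda>x. extensions q (take k (W x)) (a x))"
  using assms(1)
proof (induction k arbitrary: W)
  case 0
  then show ?case by (simp add: extensions_def) (intro ptime_intros assms)
next
  case (Suc k)
  have "extensions q (take (Suc k) w) a =
    (if w = [] then [a] else extend_at q (hd w) (extensions q (take k (tl w)) a))" for w a
    by (cases w) (auto simp: extensions_def)
  then show ?case
    by (simp only:) (intro ptime_intros ptime_extend_at Suc.IH assms Suc.prems)
qed

lemma ptime_keep:
  assumes "ptime i" "ptime l" "ptime m" shows "ptime (\<lambda>x. keep (i x) (l x) (m x))"
proof -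
  have eq: "keep I L M = rec_list [] (\<lambda>B M r. if (\<forall>B'\<in>set L. \<not> (safe I B' B \<and> cost I B' < cost I B)) \<and>
     (\<forall>B'\<in>set M. \<not> (safe I B' B \<and> cost I B' \<le> cost I B)) then B # r else r) M" for I L M
    by (induction M) auto
  have le: "esize (keep I L M) \<le> esize M" for I L M
    by (induction M) auto
  show ?thesis unfolding eq
  proof (intro ptime_fold)
    show "poly_in esize (\<lambda>p. esize (rec_list [] (\<lambda>B M r. if (\<forall>B'\<in>set (l (fst p)). \<not> (safe (i (fst p)) B' B \<and> cost (i (fst p)) B' < cost (i (fst p)) B)) \<and>
     (\<forall>B'\<in>set M. \<not> (safe (i (fst p)) B' B \<and> cost (i (fst p)) B' \<le> cost (i (fst p)) B)) then B # r else r) (snd p)))"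
      unfolding eq[symmetric]
    proof (rule poly_in_le[OF poly_in_self])
      show "esize (keep (i (fst p)) (l (fst p)) (snd p)) \<le> esize p" for p
        using le[of "i (fst p)" "l (fst p)" "snd p"] by (simp add: esize_prod)
    qed
  qed (intro ptime_intros ptime_safe ptime_cost assms assms[THEN ptime_comp])+
qed

lemma ptime_children:
  assumes "ptime i" "ptime W" "ptime a" shows "ptime (\<lambda>x. children q (i x) (take k (W x)) (a x))"
  unfolding children_def
  by (intro ptime_intros ptime_keep ptime_extensions ptime_valid assms assms[THEN ptime_comp])

text \<open>Brings a filtered list into the form \<open>take k\<close> that the rule for
  \<open>extensions\<close> expects.\<close>

lemma filter_take_take: "take k (filter R (take k xs)) = filter R (take k xs)"
  by (rule take_all) (auto intro: order_trans[OF length_filter_le])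

lemma ptime_take:
  assumes "ptime f" shows "ptime (\<lambda>x. take k (f x))"
  using assms
proof (induction k arbitrary: f)
  case 0
  then show ?case by simp (intro ptime_intros)
next
  case (Suc k)
  have "take (Suc k) xs = (if xs = [] then [] else hd xs # take k (tl xs))" for xs :: "'b list"
    by (cases xs) auto
  then show ?case by (simp only:) (intro ptime_intros Suc)
qed

lemma ptime_reducible:
  assumes "ptime i" "ptime W" "ptime a" shows "ptime (\<lambda>x. reducible q (i x) (a x) (take k (W x)))"
proof -
  have "ptime (\<lambda>x. extensions q (take k (filter (in_hub (i x)) (take k (W x)))) (a x))"
    by (intro ptime_extensions ptime_filter ptime_take ptime_in_hub ptime_intros assms assms[THEN ptime_comp])
  then show ?thesis
    unfolding reducible_def filter_take_take
    by (intro ptime_conj ptime_disj ptime_less ptime_le ptime_length ptime_const ptime_extensions ptime_children assms)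
qed

lemma ptime_words:
  assumes "ptime V" shows "ptime (\<lambda>x. words k (V x))"
proof (induction k)
  case 0
  then show ?case by simp (intro ptime_intros)
next
  case (Suc k)
  then show ?case by simp (intro ptime_intros assms assms[THEN ptime_comp])
qed

lemma set_words: "set (words k V) = {W. length W \<le> k \<and> set W \<subseteq> set V}"
proof (induction k)
  case (Suc k)
  have "W \<in> set (words (Suc k) V) \<longleftrightarrow> length W \<le> Suc k \<and> set W \<subseteq> set V" for W
    by (cases W) (auto simp: Suc)
  then show ?case by blast
qed auto

lemma ptime_branch:
  assumes "ptime i" "ptime a" shows "ptime (\<lambda>x. branch q w (i x) (a x))"
proof -
  \<comment> \<open>All members of \<open>words w\<close> have length at most \<open>w\<close>, so
    inserting \<open>take w\<close> changes nothing and makes the rules for bounded lists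
    applicable.\<close>
  have eq: "branch q w I A = (if \<not> filter (\<lambda>W. reducible q I A (take w W)) (words w (vertices I)) = []
    then children q I (take w (hd (filter (\<lambda>W. reducible q I A (take w W)) (words w (vertices I))))) A
    else if \<not> filter (\<lambda>v. in_hub I v \<and> \<not> assigned A v) (vertices I) = []
      then [(hd (filter (\<lambda>v. in_hub I v \<and> \<not> assigned A v) (vertices I)), 1) # A] else [])" for I A
  proof -
    have f: "filter (\<lambda>W. reducible q I A (take w W)) (words w (vertices I)) =
      filter (reducible q I A) (words w (vertices I))" (is "?l = ?r")
      by (rule filter_cong) (auto simp: set_words)
    have "take w (hd ?r) = hd ?r" if "?r \<noteq> []"
      using hd_in_set[OF that] by (auto simp: set_words)
    then show ?thesis unfolding f branch_def Let_def by auto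
  qed
  show ?thesis unfolding eq
    by (intro ptime_intros ptime_reducible ptime_children ptime_words ptime_vertices ptime_in_hub ptime_assigned
      assms assms[THEN ptime_comp])
qed

section \<open>Search trees\<close>

text \<open>\<open>\<mu>\<close> bounds the depth below a state and \<open>b ^ \<nu> s\<close> the
  number of leaves: the inequality for children makes their leaf budgets add up to at most that of
  the parent. \<open>Res s r\<close> says that \<open>r\<close> is an acceptable answer for
  \<open>s\<close>, and \<open>Best cs r\<close> that it is one for the states in \<open>cs\<close>
  together. \<open>N\<close> bounds all codes that occur, so calls of \<open>step\<close> and
  \<open>pick\<close> have a uniform cost.\<close>

locale search_problem =
  fixes step :: "'a :: encodable \<Rightarrow> 'a list" and pick :: "'a \<times> 'a \<Rightarrow> 'a"
    and D :: "'a set" and N :: nat and \<mu> \<nu> :: "'a \<Rightarrow> nat" and b :: real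
    and Res :: "'a \<Rightarrow> 'a \<Rightarrow> bool" and Best :: "'a list \<Rightarrow> 'a \<Rightarrow> bool"
  assumes size: "s \<in> D \<Longrightarrow> esize s \<le> N"
    and child: "s \<in> D \<Longrightarrow> c \<in> set (step s) \<Longrightarrow>
      c \<in> D \<and> \<mu> c < \<mu> s \<and> real (length (step s)) * b ^ \<nu> c \<le> b ^ \<nu> s"
    and Res_in: "Res s r \<Longrightarrow> r \<in> D" and Best_in: "Best cs r \<Longrightarrow> r \<in> D"
    and Res_leaf: "s \<in> D \<Longrightarrow> step s = [] \<Longrightarrow> Res s s"
    and Res_step: "s \<in> D \<Longrightarrow> step s \<noteq> [] \<Longrightarrow> Best (step s) r \<Longrightarrow> Res s r"
    and Best_single: "Res c r \<Longrightarrow> Best [c] r"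
    and Best_Cons: "Res c r \<Longrightarrow> Best cs r' \<Longrightarrow> Best (c # cs) (pick (r, r'))"
    and base: "1 \<le> b"

text \<open>\<open>P\<close> and \<open>T\<close> are chosen before the search problem, so one
  program serves all graphs. Out of the budget \<open>T N * (\<mu> s + 1) * b ^ \<nu> s\<close> the
  children consume at most \<open>T N * \<mu> s * b ^ \<nu> s\<close>; the rest pays for the work at
  the node itself.\<close>

lemma tree_search:
  fixes step :: "'a :: encodable \<Rightarrow> 'a list" and pick :: "'a \<times> 'a \<Rightarrow> 'a"
  assumes step: "ptime step" and pick: "ptime pick"
  obtains P T where "poly_in (\<lambda>N. N) T"
    "\<forall>D N \<mu> \<nu> b Res Best. search_problem step pick D N \<mu> \<nu> b Res Best \<longrightarrow> (\<forall>s\<in>D.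
      \<exists>r t. Res s r \<and> computes_in P (encode s) (encode r) t \<and> real t \<le> real (T N) * (real (\<mu> s) + 1) * b ^ \<nu> s)"
proof -
  obtain PS c1 where S: "\<And>x. \<exists>t \<le> c1 * (esize x + 1) ^ c1. computes_in PS (encode x) (encode (step x)) t"
    by (rule ptimeE[OF step]) (rule that)
  obtain PK c2 where K: "\<And>x. \<exists>t \<le> c2 * (esize x + 1) ^ c2. computes_in PK (encode x) (encode (pick x)) t"
    by (rule ptimeE[OF pick]) (rule that)
  \<comment> \<open>Functions 0 and 1 are mutually recursive: \<open>solve\<close> treats a state,
    \<open>best\<close> a nonempty list of states. Function 2 is \<open>step\<close>, and function
    \<open>2 + length PS\<close> is \<open>pick\<close>.\<close>
  define solve where "solve = ELet (ECall 2 [EVar 0]) (EIf (EVar 0) (ECall 1 [EVar 0]) (EVar 1))"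
  define best where "best = EIf (ERight (EVar 0))
    (ECall (2 + length PS) [ENode (ECall 0 [ELeft (EVar 0)]) (ECall 1 [ERight (EVar 0)])]) (ECall 0 [ELeft (EVar 0)])"
  define A where "A = [solve, best]"
  define R where "R = link (link A PS) PK"
  have R: "R = link A PS @ map (shift (length (link A PS))) PK" "R = link (link A PS) PK @ []"
    by (auto simp: R_def link_def)
  have R01: "R ! 0 = solve" "R ! 1 = best" "0 < length R" "1 < length R" "R \<noteq> []"
    by (auto simp: R_def link_def A_def)
  define \<tau> where "\<tau> N = c1 * (N + 1) ^ c1 + c2 * ((2 * N + 1) + 1) ^ c2 + 20" for N
  show thesis
  proof (rule that)
    \<comment> \<open>A node uses one \<open>\<tau> N\<close> for \<open>step\<close> and one per
      child. Both amounts are at most \<open>b ^ \<nu> s * \<tau> N\<close>, hence the factor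
      2.\<close>
    show "poly_in (\<lambda>N. N) (\<lambda>N. 2 * \<tau> N)"
      unfolding \<tau>_def by (intro poly_intros)
  next
    show "\<forall>D N \<mu> \<nu> b Res Best. search_problem step pick D N \<mu> \<nu> b Res Best \<longrightarrow> (\<forall>s\<in>D.
      \<exists>r t. Res s r \<and> computes_in R (encode s) (encode r) t \<and> real t \<le> real (2 * \<tau> N) * (real (\<mu> s) + 1) * b ^ \<nu> s)"
    proof (intro allI impI ballI)
      fix D N \<mu> \<nu> b Res Best s
      assume "search_problem step pick D N \<mu> \<nu> b Res Best" and s: "s \<in> D"
      then interpret search_problem step pick D N \<mu> \<nu> b Res Best by simp
      define B where "B s = real (2 * \<tau> N) * (real (\<mu> s) + 1) * b ^ \<nu> s" for s
      have "\<exists>r t. Res s r \<and> eval R [encode s] solve (encode r) t \<and> real t \<le> B s"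
        using s
      proof (induction s rule: measure_induct_rule[of \<mu>])
        case (less s)
        obtain t0 where t0: "t0 \<le> c1 * (esize s + 1) ^ c1" "computes_in PS (encode s) (encode (step s)) t0"
          using S by blast
        have t0_le: "t0 + 20 \<le> \<tau> N"
        proof -
          have "c1 * (esize s + 1) ^ c1 \<le> c1 * (N + 1) ^ c1"
            using size[OF less.prems] by (intro mult_le_mono2 power_mono) auto
          with t0(1) show ?thesis unfolding \<tau>_def by linarith
        qed
        have f: "2 < length R" "eval R [encode s] (R ! 2) (encode (step s)) t0"
          using computes_in_link[OF t0(2), of A, folded R(1)] unfolding R(1) by (auto simp: A_def numeral_2_eq_2)
        have call: "eval R [encode s] (ECall 2 [EVar 0]) (encode (step s)) (Suc 0 + t0 + 1)"
          by (rule eval_Call1[OF eval_Var f]) auto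
        show ?case
        proof (cases "step s")
          case Nil
          have "eval R [encode s] solve (encode s) ((Suc 0 + t0 + 1) + (Suc 0 + Suc 0 + 1) + 1)"
            unfolding solve_def by (rule Let[OF call IfFalse[OF eval_Var _ eval_Var]]) (auto simp: Nil)
          moreover have "real ((Suc 0 + t0 + 1) + (Suc 0 + Suc 0 + 1) + 1) \<le> B s"
          proof -
            have "real (\<tau> N) \<le> real (2 * \<tau> N) * 1 * 1" by simp
            also have "\<dots> \<le> B s"
              unfolding B_def using base by (intro mult_mono one_le_power) auto
            finally show ?thesis using t0_le by linarith
          qed
          ultimately show ?thesis using Res_leaf[OF less.prems Nil] by blast
        next
          case (Cons c0 cs0)
          have best: "\<exists>r t. Best cs r \<and> eval R [encode cs] best (encode r) t \<and>
              real t \<le> real (length cs) * real (\<tau> N) + (\<Sum>c\<leftarrow>cs. B c)"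
            if "cs \<noteq> []" "set cs \<subseteq> set (step s)" for cs
            using that
          proof (induction cs)
            case (Cons c cs)
            from Cons.prems child[OF less.prems] have "\<mu> c < \<mu> s" "c \<in> D" by auto
            from less.IH[OF this] obtain r t where r: "Res c r" "eval R [encode c] (R ! 0) (encode r) t" "real t \<le> B c"
              unfolding R01 by blast
            show ?case
            proof (cases "cs = []")
              case True
              have "eval R [encode (c # cs)] best (encode r) ((Suc 0 + 1) + ((Suc 0 + 1) + t + 1) + 1)"
                unfolding best_def
                by (rule IfFalse[OF eval_Right[OF eval_Var] _ eval_Call1[OF eval_Left[OF eval_Var] R01(3) r(2)]])
                  (auto simp: True)
              moreover have "Best (c # cs) r" using Best_single[OF r(1)] True by simp
              ultimately show ?thesis using r(3) t0_le True
                by (intro exI[of _ r] exI[of _ "(Suc 0 + 1) + ((Suc 0 + 1) + t + 1) + 1"]) auto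
            next
              case False
              with Cons obtain r' t' where r': "Best cs r'" "eval R [encode cs] (R ! 1) (encode r') t'"
                "real t' \<le> real (length cs) * real (\<tau> N) + (\<Sum>c\<leftarrow>cs. B c)"
                unfolding R01 by auto
              obtain tp where tp: "tp \<le> c2 * (esize (r, r') + 1) ^ c2"
                "computes_in PK (encode (r, r')) (encode (pick (r, r'))) tp"
                using K by blast
              have tp_le: "tp + 20 \<le> \<tau> N"
              proof -
                have "esize (r, r') \<le> 2 * N + 1"
                  using size[OF Res_in[OF r(1)]] size[OF Best_in[OF r'(1)]] by simp
                then have "c2 * (esize (r, r') + 1) ^ c2 \<le> c2 * ((2 * N + 1) + 1) ^ c2"
                  by (intro mult_le_mono2 power_mono) auto
                with tp(1) show ?thesis unfolding \<tau>_def by linarith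
              qed
              have g: "2 + length PS < length R" "eval R [encode (r, r')] (R ! (2 + length PS)) (encode (pick (r, r'))) tp"
                using computes_in_link[OF tp(2), of "link A PS" "[]", folded R(2)] by (auto simp: A_def)
              have env: "eval R [encode (c # cs)] (EVar 0) (Node (encode c) (encode cs)) (Suc 0)"
                by (rule eval_Var) auto
              have ne: "encode cs \<noteq> Leaf" using False by (cases cs) auto
              have "\<exists>u. u \<le> t + t' + tp + 20 \<and> eval R [encode (c # cs)] best (encode (pick (r, r'))) u"
                unfolding best_def
                by (rule exI, rule conjI[rotated], rule IfTrue[OF eval_Right[OF env] ne eval_Call1[OF Node[OF
                    eval_Call1[OF eval_Left[OF env] R01(3) r(2)] eval_Call1[OF eval_Right[OF env] R01(4) r'(2)]]
                    g[unfolded encode_simps]]]) auto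
              then obtain u where u: "u \<le> t + t' + tp + 20" "eval R [encode (c # cs)] best (encode (pick (r, r'))) u"
                by blast
              have "real u \<le> real (length (c # cs)) * real (\<tau> N) + (\<Sum>c\<leftarrow>c # cs. B c)"
              proof -
                have "real u \<le> real t + real t' + real (\<tau> N)" using u(1) tp_le by linarith
                then show ?thesis using r(3) r'(3) by (simp add: algebra_simps)
              qed
              with u(2) Best_Cons[OF r(1) r'(1)] show ?thesis by blast
            qed
          qed auto
          define m where "m = real (length (step s))"
          have m: "1 \<le> m" unfolding m_def Cons by simp
          obtain r t where r: "Best (step s) r" "eval R [encode (step s)] (R ! 1) (encode r) t"
              "real t \<le> m * real (\<tau> N) + (\<Sum>c\<leftarrow>step s. B c)"
            using best[of "step s"] Cons unfolding R01 m_def by auto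
          \<comment> \<open>Each child has \<open>\<mu> c + 1 \<le> \<mu> s\<close> and
            \<open>b ^ \<nu> c \<le> b ^ \<nu> s / m\<close>, and there are \<open>m\<close> of
            them.\<close>
          have sum: "(\<Sum>c\<leftarrow>step s. B c) \<le> real (2 * \<tau> N) * real (\<mu> s) * b ^ \<nu> s"
          proof -
            have "B c \<le> real (2 * \<tau> N) * real (\<mu> s) * (b ^ \<nu> s / m)" if c: "c \<in> set (step s)" for c
            proof -
              have "m * b ^ \<nu> c \<le> b ^ \<nu> s" "\<mu> c < \<mu> s" using child[OF less.prems c] by (auto simp: m_def)
              then show ?thesis unfolding B_def using m base
                by (intro mult_mono) (auto simp: field_simps)
            qed
            then have "(\<Sum>c\<leftarrow>step s. B c) \<le> (\<Sum>c\<leftarrow>step s. real (2 * \<tau> N) * real (\<mu> s) * (b ^ \<nu> s / m))"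
              by (intro sum_list_mono)
            also have "\<dots> = real (2 * \<tau> N) * real (\<mu> s) * b ^ \<nu> s"
              using m by (simp add: sum_list_triv m_def[symmetric])
            finally show ?thesis .
          qed
          have m_le: "m \<le> b ^ \<nu> s"
          proof -
            have "m * 1 \<le> m * b ^ \<nu> c0" using m base by (intro mult_left_mono one_le_power) auto
            also have "\<dots> \<le> b ^ \<nu> s" using child[OF less.prems, of c0] Cons by (auto simp: m_def)
            finally show ?thesis by simp
          qed
          have ne: "encode (step s) \<noteq> Leaf" using Cons by simp
          have "\<exists>u. u \<le> t0 + t + 20 \<and> eval R [encode s] solve (encode r) u"
            unfolding solve_def
            by (rule exI, rule conjI[rotated], rule Let[OF call IfTrue[OF eval_Var ne eval_Call1[OF eval_Var R01(4) r(2)]]]) auto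
          then obtain u where u: "u \<le> t0 + t + 20" "eval R [encode s] solve (encode r) u" by blast
          have "real u \<le> B s"
          proof -
            have "real u \<le> real (\<tau> N) + m * real (\<tau> N) + real (2 * \<tau> N) * real (\<mu> s) * b ^ \<nu> s"
              using u(1) t0_le r(3) sum by linarith
            moreover have "real (\<tau> N) \<le> b ^ \<nu> s * real (\<tau> N)" using one_le_power[OF base] by (simp add: mult_le_cancel_right1)
            moreover have "m * real (\<tau> N) \<le> b ^ \<nu> s * real (\<tau> N)" using m_le by (intro mult_right_mono) auto
            moreover have "B s = 2 * (b ^ \<nu> s * real (\<tau> N)) + real (2 * \<tau> N) * real (\<mu> s) * b ^ \<nu> s"
              unfolding B_def by (simp add: algebra_simps)
            ultimately show ?thesis by linarith
          qed
          moreover have "Res s r" using Res_step[OF less.prems _ r(1)] Cons by simp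
          ultimately show ?thesis using u(2) by blast
        qed
    qed
    then show "\<exists>r t. Res s r \<and> computes_in R (encode s) (encode r) t \<and> real t \<le> real (2 * \<tau> N) * (real (\<mu> s) + 1) * b ^ \<nu> s"
      unfolding computes_in_def B_def using R01 by simp
    qed
  qed
qed

section \<open>Correctness of the branching step\<close>

lemma assigned_simps [simp]:
  "\<not> assigned [] u" "assigned (e # B) u \<longleftrightarrow> fst e = u \<or> assigned B u"
  "assigned (B @ B') u \<longleftrightarrow> assigned B u \<or> assigned B' u"
  by (auto simp: assigned_def)

lemma assignedE: 
  assumes "assigned B u" obtains c where "(u, c) \<in> set B"
  using assms by (auto simp: assigned_def)

lemma extensions_Nil [simp]: "extensions q [] A = [A]"
  by (simp add: extensions_def)

lemma extensions_Cons [simp]: "extensions q (u # W) A = extend_at q u (extensions q W A)"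
  by (simp add: extensions_def)

lemma set_extend_at:
  "set (extend_at q u L) = {B \<in> set L. assigned B u} \<union> {(u, c) # B | c B. B \<in> set L \<and> \<not> assigned B u \<and> c \<le> q}"
  by (force simp: extend_at_def split: if_splits)

definition restrict :: "(nat \<Rightarrow> nat) \<Rightarrow> nat list \<Rightarrow> state \<Rightarrow> state" where
  "restrict f W A = foldr (\<lambda>u B. if assigned B u then B else (u, f u) # B) W A"

lemma restrict_simps [simp]:
  "restrict f [] A = A"
  "restrict f (u # W) A = (if assigned (restrict f W A) u then restrict f W A else (u, f u) # restrict f W A)"
  by (auto simp: restrict_def)

lemma assigned_restrict [simp]: "assigned (restrict f W A) u \<longleftrightarrow> assigned A u \<or> u \<in> set W"
  by (induction W) auto

lemma set_restrict: "set (restrict f W A) = set A \<union> {(u, f u) | u. u \<in> set W \<and> \<not> assigned A u}"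
  by (induction W) auto

lemma restrict_in_extensions: "\<forall>u\<in>set W. f u \<le> q \<Longrightarrow> restrict f W A \<in> set (extensions q W A)"
  by (induction W) (auto simp: set_extend_at)

definition completes :: "(nat \<Rightarrow> nat) \<Rightarrow> state \<Rightarrow> bool" where
  "completes f A \<longleftrightarrow> (\<forall>e\<in>set A. f (fst e) = snd e)"

lemma completes_Cons [simp]: "completes f (e # A) \<longleftrightarrow> f (fst e) = snd e \<and> completes f A"
  by (auto simp: completes_def)

lemma completes_restrict: "completes f A \<Longrightarrow> completes f (restrict f W A)"
  by (induction W) auto

text \<open>At each fresh vertex only one choice agrees with \<open>f\<close>, so a completion
  singles out its extension.\<close>

lemma extensions_eq_restrict:
  "B \<in> set (extensions q W A) \<Longrightarrow> completes f B \<Longrightarrow> B = restrict f W A"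
proof (induction W arbitrary: B)
  case (Cons u W)
  from Cons.prems(1) consider "B \<in> set (extensions q W A)" "assigned B u" |
    c B' where "B = (u, c) # B'" "B' \<in> set (extensions q W A)" "\<not> assigned B' u"
    by (auto simp: set_extend_at)
  then show ?case
  proof cases
    case 1
    with Cons.IH[OF 1(1) Cons.prems(2)] show ?thesis by auto
  next
    case 2
    with Cons.IH[OF 2(2)] Cons.prems(2) show ?thesis by auto
  qed
qed auto

lemma extensions_assigned:
  "B \<in> set (extensions q W A) \<Longrightarrow> assigned B u \<longleftrightarrow> assigned A u \<or> u \<in> set W"
  by (induction W arbitrary: B) (auto simp: set_extend_at)

lemma extensions_superset: "B \<in> set (extensions q W A) \<Longrightarrow> set A \<subseteq> set B"
  by (induction W arbitrary: B) (fastforce simp: set_extend_at)+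

text \<open>All members of \<open>extensions q W A\<close> have the same domain, so a fresh vertex
  multiplies the length uniformly by \<open>Suc q\<close>.\<close>

lemma length_extensions:
  "length (extensions q W A) = Suc q ^ card {u \<in> set W. \<not> assigned A u}"
proof (induction W)
  case (Cons u W)
  have "length (extend_at q u L) = (if as then length L else Suc q * length L)"
    if "\<forall>B\<in>set L. assigned B u = as" for L as
    using that by (induction L) (auto simp: extend_at_def)
  from this[of "extensions q W A" "assigned A u \<or> u \<in> set W"]
  have len: "length (extensions q (u # W) A) = (if assigned A u \<or> u \<in> set W then length (extensions q W A) else Suc q * length (extensions q W A))"
    using extensions_assigned by auto
  show ?case
  proof (cases "assigned A u \<or> u \<in> set W")
    case True
    then have "{x \<in> set (u # W). \<not> assigned A x} = {x \<in> set W. \<not> assigned A x}" by auto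
    then show ?thesis using True Cons len by simp
  next
    case False
    then have "{x \<in> set (u # W). \<not> assigned A x} = insert u {x \<in> set W. \<not> assigned A x}" by auto
    then show ?thesis using False Cons len by simp
  qed
qed auto

text \<open>\<open>foldr\<close> treats \<open>K\<close> after \<open>S\<close>, so the entries for
  \<open>K\<close> form a prefix of known length, and dropping it leaves an extension over
  \<open>S\<close>.\<close>

lemma extensions_split:
  assumes "distinct K" "\<forall>u\<in>set K. \<not> assigned A u \<and> u \<notin> set S" "B \<in> set (extensions q (K @ S) A)"
  shows "drop (length K) B \<in> set (extensions q S A) \<and> map fst (take (length K) B) = K"
  using assms
proof (induction K arbitrary: B)
  case (Cons u K)
  from Cons.prems(3) consider "B \<in> set (extensions q (K @ S) A)" "assigned B u" |
    c B' where "B = (u, c) # B'" "B' \<in> set (extensions q (K @ S) A)" "\<not> assigned B' u"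
    by (auto simp: set_extend_at)
  then show ?case
  proof cases
    case 1
    with Cons.prems extensions_assigned[OF 1(1)] show ?thesis by auto
  next
    case 2
    with Cons show ?thesis by auto
  qed
qed auto

section \<open>The survivors of \<open>keep\<close>\<close>

lemma set_keep_subset: "set (keep I L M) \<subseteq> set M"
  by (induction M) auto

lemma length_keep: "length (keep I L M) \<le> length M"
  by (induction M) auto

lemma safe_refl: "safe I B B"
  by (auto simp: safe_def)

lemma distinct_keep: "distinct (keep I L M)"
proof (induction M)
  case (Cons B M)
  have "B \<notin> set (keep I L M)" if "\<forall>B'\<in>set M. \<not> (safe I B' B \<and> cost I B' \<le> cost I B)"
    using that set_keep_subset[of I L M] safe_refl by blast
  with Cons show ?case by auto
qed auto

lemma keepI:
  assumes "\<forall>B'\<in>set L. \<not> (safe I B' B \<and> cost I B' < cost I B)"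
    "\<forall>B'\<in>set rest. \<not> (safe I B' B \<and> cost I B' \<le> cost I B)"
  shows "B \<in> set (keep I L (pre @ B # rest))"
  using assms by (induction pre) auto

lemma keep_minimal:
  "B \<in> set (keep I L M) \<Longrightarrow> B' \<in> set L \<Longrightarrow> safe I B' B \<Longrightarrow> cost I B \<le> cost I B'"
  by (induction M) (auto simp: not_less split: if_splits)

text \<open>Mutual safety forces equal cost by \<open>keep_minimal\<close>. If the two states were
  different, the earlier one would have been removed in favour of the later one.\<close>

lemma keep_inj:
  assumes "B1 \<in> set (keep I L M)" "B2 \<in> set (keep I L M)" "safe I B1 B2" "safe I B2 B1" "set M \<subseteq> set L"
  shows "B1 = B2"
  using assms
proof (induction M)
  case (Cons B M)
  have sub: "set (keep I L M) \<subseteq> set M" by (rule set_keep_subset)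
  have mem: "B1 \<in> set L" "B2 \<in> set L" using Cons.prems set_keep_subset by blast+
  have eq: "cost I B1 = cost I B2"
    using keep_minimal[OF Cons.prems(1) mem(2) Cons.prems(4)] keep_minimal[OF Cons.prems(2) mem(1) Cons.prems(3)]
    by simp
  show ?case
  proof (cases "B1 \<in> set (keep I L M) \<and> B2 \<in> set (keep I L M)")
    case True
    with Cons show ?thesis by auto
  next
    case False
    with Cons.prems(1,2) eq sub Cons.prems(3,4) show ?thesis by (auto split: if_splits)
  qed
qed auto

text \<open>The set \<open>K\<close> in \<open>hub_component\<close> plays the role of a component;
  with its hub neighbours it fits into one list of length \<open>w\<close>. The bound
  \<open>2 \<le> w\<close> makes room for the two ends of an edge inside the hub.\<close>

locale colouring_instance =
  fixes I :: inst and q w :: nat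
  assumes adj_sym: "adj I u v \<Longrightarrow> adj I v u"
    and adj_irrefl: "\<not> adj I u u"
    and adj_bound: "adj I u v \<Longrightarrow> u < length (fst I)"
    and hub_bound: "in_hub I v \<Longrightarrow> v < length (fst I)"
    and q_pos: "1 \<le> q" and w_ge: "2 \<le> w"
    and hub_component: "x < length (fst I) \<Longrightarrow> \<not> in_hub I x \<Longrightarrow>
      \<exists>K. x \<in> K \<and> (\<forall>u\<in>K. u < length (fst I) \<and> \<not> in_hub I u) \<and>
        (\<forall>u\<in>K. \<forall>v. adj I u v \<longrightarrow> \<not> in_hub I v \<longrightarrow> v \<in> K) \<and>
        card K + card {v. in_hub I v \<and> (\<exists>u\<in>K. adj I u v)} \<le> w"
begin

abbreviation n :: nat where "n \<equiv> length (fst I)"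

definition wf_state :: "state \<Rightarrow> bool" where
  "wf_state A \<longleftrightarrow> distinct (map fst A) \<and> (\<forall>e\<in>set A. fst e < n \<and> snd e \<le> q)"

definition col :: "(nat \<Rightarrow> nat) \<Rightarrow> bool" where
  "col f \<longleftrightarrow> (\<forall>v<n. f v \<le> q) \<and> (\<forall>u v. adj I u v \<longrightarrow> f u = 0 \<or> f v = 0 \<or> f u \<noteq> f v)"

definition wgt :: "nat \<Rightarrow> nat" where
  "wgt v = (if in_hub I v then n else Suc n)"

definition pay :: "(nat \<Rightarrow> nat) \<Rightarrow> nat \<Rightarrow> nat" where
  "pay f v = (if f v = 0 then wgt v else 0)"

definition total :: "(nat \<Rightarrow> nat) \<Rightarrow> nat" where
  "total f = (\<Sum>v<n. pay f v)"

text \<open>\<open>cost\<close> is defined as the length of a list so that its computability is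
  visible without arithmetic. Here it becomes a weighted sum.\<close>

lemma cost_simps [simp]:
  "cost I [] = 0" "cost I (e # B) = (if snd e = 0 then wgt (fst e) else 0) + cost I B"
  by (auto simp: cost_def wgt_def vertices_def)

lemma cost_restrict:
  assumes "completes f A"
  shows "cost I (restrict f W A) = cost I A + (\<Sum>u \<in> {u \<in> set W. \<not> assigned A u}. pay f u)"
proof (induction W)
  case (Cons u W)
  show ?case
  proof (cases "assigned A u \<or> u \<in> set W")
    case True
    then have "{x \<in> set (u # W). \<not> assigned A x} = {x \<in> set W. \<not> assigned A x}" by auto
    then show ?thesis using True Cons by simp
  next
    case False
    then have "{x \<in> set (u # W). \<not> assigned A x} = insert u {x \<in> set W. \<not> assigned A x}" by auto
    then show ?thesis using False Cons by (simp add: pay_def)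
  qed
qed auto

lemma cost_eq_sum:
  assumes "wf_state B" "completes f B"
  shows "cost I B = (\<Sum>u \<in> {u. u < n \<and> assigned B u}. pay f u)"
proof -
  have "cost I B = (\<Sum>u \<in> fst ` set B. pay f u)"
    using assms unfolding wf_state_def by (induction B) (auto simp: pay_def)
  moreover have "fst ` set B = {u. u < n \<and> assigned B u}"
    using assms(1) by (auto simp: wf_state_def assigned_def)
  ultimately show ?thesis by simp
qed

lemma total_split:
  "total f = (\<Sum>u \<in> {u. u < n \<and> assigned B u}. pay f u) + (\<Sum>u \<in> {u. u < n \<and> \<not> assigned B u}. pay f u)"
  unfolding total_def
  by (subst sum.union_disjoint[symmetric]) (auto intro!: sum.cong)

definition override :: "(nat \<Rightarrow> nat) \<Rightarrow> state \<Rightarrow> nat \<Rightarrow> nat" where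
  "override g B v = (case map_of B v of None \<Rightarrow> g v | Some c \<Rightarrow> c)"

lemma override_mem:
  assumes "wf_state B" "(u, c) \<in> set B" shows "override g B u = c"
  using assms by (auto simp: override_def wf_state_def)

lemma override_unassigned: "\<not> assigned B u \<Longrightarrow> override g B u = g u"
  by (force simp: override_def assigned_def split: option.splits dest!: map_of_SomeD)

lemma completes_override: "wf_state B \<Longrightarrow> completes (override g B) B"
  by (auto simp: completes_def intro: override_mem)

lemma override_le:
  assumes "wf_state B" "g v \<le> q" shows "override g B v \<le> q"
  using assms by (auto simp: override_def wf_state_def split: option.splits dest!: map_of_SomeD)

lemma valid_override_edge:
  assumes "wf_state B" "valid I B" "adj I u v" "assigned B u" "assigned B v"
  shows "override g B u = 0 \<or> override g B v = 0 \<or> override g B u \<noteq> override g B v"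
proof -
  from assms(4,5) obtain c d where "(u, c) \<in> set B" "(v, d) \<in> set B" by (auto elim!: assignedE)
  with assms(1-3) show ?thesis by (force simp: valid_def override_mem)
qed

lemma col_valid: "col f \<Longrightarrow> completes f B \<Longrightarrow> valid I B"
  unfolding col_def completes_def valid_def by metis

text \<open>Only an edge from the domain to the outside is critical. Its inner end is deleted by
  \<open>B'\<close>, or has the same value as in \<open>B\<close> and thus in \<open>g\<close>, or
  is enclosed, which is impossible as the outer end is unassigned.\<close>

lemma col_override:
  assumes "col g" "completes g B" "wf_state B'" "valid I B'" "safe I B' B" "\<And>u. assigned B u = assigned B' u"
  shows "col (override g B')"
proof -
  have edge: "override g B' u = 0 \<or> override g B' v = 0 \<or> override g B' u \<noteq> override g B' v"
    if "adj I u v" "assigned B' u" "\<not> assigned B' v" for u v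
  proof -
    from that(2) obtain c where c: "(u, c) \<in> set B'" by (rule assignedE)
    have "\<not> enclosed I B u"
      using that adj_bound[OF adj_sym[OF that(1)]] assms(6) by (auto simp: enclosed_def vertices_def)
    with assms(5) c have "c = 0 \<or> (u, c) \<in> set B" by (force simp: safe_def)
    then have "override g B' u = 0 \<or> override g B' u = g u"
      using assms(2) override_mem[OF assms(3) c] by (auto simp: completes_def)
    moreover have "g u = 0 \<or> g v = 0 \<or> g u \<noteq> g v" using assms(1) that(1) by (simp add: col_def)
    ultimately show ?thesis using override_unassigned[OF that(3)] by auto
  qed
  have "override g B' u = 0 \<or> override g B' v = 0 \<or> override g B' u \<noteq> override g B' v" if e: "adj I u v" for u v
  proof (cases "assigned B' u"; cases "assigned B' v")
    assume "assigned B' u" "assigned B' v"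
    with valid_override_edge[OF assms(3,4) e] show ?thesis by blast
  next
    assume "assigned B' u" "\<not> assigned B' v"
    with edge[OF e] show ?thesis by blast
  next
    assume "\<not> assigned B' u" "assigned B' v"
    with edge[OF adj_sym[OF e]] show ?thesis by metis
  next
    assume "\<not> assigned B' u" "\<not> assigned B' v"
    with assms(1) e show ?thesis by (simp add: override_unassigned col_def)
  qed
  moreover have "override g B' v \<le> q" if "v < n" for v
    using override_le[OF assms(3)] assms(1) that by (simp add: col_def)
  ultimately show ?thesis by (auto simp: col_def)
qed

lemma total_override:
  assumes "wf_state B" "completes g B" "wf_state B'" "\<And>u. assigned B u = assigned B' u"
  shows "total (override g B') + cost I B = total g + cost I B'"
proof -
  have "(\<Sum>u \<in> {u. u < n \<and> \<not> assigned B' u}. pay (override g B') u) = (\<Sum>u \<in> {u. u < n \<and> \<not> assigned B' u}. pay g u)"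
    by (rule sum.cong) (auto simp: pay_def override_unassigned)
  then show ?thesis
    using total_split[of "override g B'" B'] total_split[of g B] cost_eq_sum[OF assms(1,2)]
      cost_eq_sum[OF assms(3) completes_override[OF assms(3)], of g] assms(4) by simp
qed

lemma extensions_wf:
  assumes "wf_state A" "\<forall>u\<in>set W. u < n" "B \<in> set (extensions q W A)"
  shows "wf_state B"
  using assms
proof (induction W arbitrary: B)
  case (Cons u W)
  from Cons.prems(3) consider "B \<in> set (extensions q W A)" |
    c B' where "B = (u, c) # B'" "B' \<in> set (extensions q W A)" "\<not> assigned B' u" "c \<le> q"
    by (auto simp: set_extend_at)
  then show ?case
  proof cases
    case 1
    with Cons show ?thesis by auto
  next
    case 2
    with Cons.IH[of B'] Cons.prems show ?thesis by (auto simp: wf_state_def assigned_def)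
  qed
qed auto

text \<open>The surviving child comes from a completion of minimum total and is the last in the list
  among the extensions that do. If some \<open>B'\<close> dominated it, exchanging it into the
  completion would give a smaller total or an optimal extension further back.\<close>

lemma children_sound:
  assumes A: "wf_state A" and W: "\<forall>u\<in>set W. u < n" and f: "col f" "completes f A"
  shows "\<exists>B\<in>set (children q I W A). \<exists>f'. col f' \<and> completes f' B \<and> total f' \<le> total f"
proof -
  define P where "P g \<longleftrightarrow> col g \<and> completes g A" for g
  define m where "m = (LEAST k. \<exists>g. P g \<and> total g = k)"
  have ex: "\<exists>g. P g \<and> total g = m"
    unfolding m_def by (rule LeastI_ex) (use f in \<open>auto simp: P_def\<close>)
  have least: "m \<le> total g" if "P g" for g
    unfolding m_def by (rule Least_le) (use that in auto)
  define L where "L = filter (valid I) (extensions q W A)"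
  define opt where "opt B \<longleftrightarrow> (\<exists>g. P g \<and> total g = m \<and> B = restrict g W A)" for B
  have in_L: "restrict g W A \<in> set L" if "P g" for g
    using that W unfolding L_def P_def
    by (auto intro!: restrict_in_extensions col_valid completes_restrict simp: col_def)
  from ex in_L have "\<exists>B\<in>set L. opt B" unfolding opt_def by metis
  from split_list_last_prop[OF this] obtain pre B rest where L: "L = pre @ B # rest" "opt B" "\<forall>B'\<in>set rest. \<not> opt B'"
    by blast
  from L(2) obtain g where g: "P g" "total g = m" "B = restrict g W A" unfolding opt_def by blast
  have gB: "completes g B" using g by (simp add: P_def completes_restrict)
  have wf: "wf_state B'" and as: "assigned B u = assigned B' u" if "B' \<in> set L" for B' u
    using that extensions_wf[OF A W] extensions_assigned[of B' q W A] unfolding g(3) L_def by auto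
  have BL: "B \<in> set L" using L(1) by simp
  \<comment> \<open>The exchange: \<open>override g B'\<close> is again a completion of
    \<open>A\<close>, and its total differs from \<open>m\<close> by the difference of the two
    costs.\<close>
  have key: "P (override g B') \<and> total (override g B') + cost I B = m + cost I B' \<and> B' = restrict (override g B') W A"
    if B': "B' \<in> set L" "safe I B' B" for B'
  proof -
    have c: "completes (override g B') B'" using completes_override[OF wf[OF B'(1)]] .
    have "P (override g B')"
      unfolding P_def
    proof
      show "col (override g B')"
        using g(1) B' wf[OF B'(1)] as[OF B'(1)] gB by (intro col_override[of g B B']) (auto simp: P_def L_def)
      show "completes (override g B') A"
        using c extensions_superset[of B' q W A] B'(1) by (auto simp: completes_def L_def)
    qed
    moreover have "total (override g B') + cost I B = total g + cost I B'"
      by (rule total_override[OF wf[OF BL] gB wf[OF B'(1)] as[OF B'(1)]])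
    moreover have "B' = restrict (override g B') W A"
      using extensions_eq_restrict[OF _ c] B'(1) by (auto simp: L_def)
    ultimately show ?thesis using g(2) by simp
  qed
  have "B \<in> set (keep I L (pre @ B # rest))"
  proof (rule keepI; intro ballI notI)
    fix B' assume "B' \<in> set L" "safe I B' B \<and> cost I B' < cost I B"
    with key[of B'] least[of "override g B'"] show False by auto
  next
    fix B' assume B': "B' \<in> set rest" "safe I B' B \<and> cost I B' \<le> cost I B"
    then have "B' \<in> set L" using L(1) by simp
    with key[of B'] least[of "override g B'"] B'(2) have "opt B'"
      unfolding opt_def by (intro exI[of _ "override g B'"]) auto
    with B'(1) L(3) show False by blast
  qed
  then have "B \<in> set (children q I W A)"
    unfolding children_def L_def[symmetric] L(1)[symmetric] .
  moreover have "col g" "total g \<le> total f" using g least[of f] f by (auto simp: P_def)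
  ultimately show ?thesis using gB by blast
qed

lemma children_D:
  assumes "B \<in> set (children q I W A)"
  shows "B \<in> set (extensions q W A)" "valid I B"
  using assms set_keep_subset unfolding children_def by fastforce+

lemma distinct_children: "distinct (children q I W A)"
  unfolding children_def by (rule distinct_keep)

section \<open>Irreducible states\<close>

lemma length_extensions_gt1:
  assumes "x \<in> set W" "\<not> assigned A x" shows "1 < length (extensions q W A)"
proof -
  have "0 < card {u \<in> set W. \<not> assigned A u}" using assms by (auto simp: card_gt_0_iff)
  then show ?thesis unfolding length_extensions using q_pos by (intro one_less_power) simp_all
qed

text \<open>\<open>W\<close> consists of free hub vertices, so the list to compare with is
  \<open>extensions q W A\<close> itself, and \<open>valid\<close> removes at least one of its
  members.\<close>

lemma reducible_invalid:
  assumes "\<forall>u\<in>set W. in_hub I u \<and> \<not> assigned A u" "W \<noteq> []" "B \<in> set (extensions q W A)" "\<not> valid I B"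
  shows "reducible q I A W"
proof -
  have "length (children q I W A) \<le> length (filter (valid I) (extensions q W A))"
    unfolding children_def by (rule length_keep)
  also have "\<dots> < length (extensions q W A)"
    using assms(3,4) by (rule length_filter_less)
  finally have "length (children q I W A) < length (extensions q W A)" .
  moreover have "filter (in_hub I) W = W" using assms(1) by (simp add: filter_id_conv)
  moreover have "1 < length (extensions q W A)"
    using assms(1,2) by (intro length_extensions_gt1[of "hd W"]) auto
  ultimately show ?thesis by (simp add: reducible_def)
qed

text \<open>\<open>K\<close> is the unassigned part of the component of \<open>x\<close>, and
  \<open>S\<close> that of its hub neighbours. Components belong to the analysis only: the algorithm
  meets \<open>K @ S\<close> among the lists it tries.\<close>

lemma component_lists:
  assumes "x < n" "\<not> in_hub I x" "\<not> assigned A x"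
  obtains K S where "distinct K" "distinct S" "x \<in> set K" "length (K @ S) \<le> w"
    "\<forall>u\<in>set K. u < n \<and> \<not> in_hub I u \<and> \<not> assigned A u"
    "\<forall>u\<in>set S. in_hub I u \<and> \<not> assigned A u"
    "\<forall>u\<in>set K. \<forall>v. adj I u v \<longrightarrow> assigned A v \<or> v \<in> set K \<or> v \<in> set S"
proof -
  obtain C where C: "x \<in> C" "\<forall>u\<in>C. u < n \<and> \<not> in_hub I u" "\<forall>u\<in>C. \<forall>v. adj I u v \<longrightarrow> \<not> in_hub I v \<longrightarrow> v \<in> C"
    "card C + card {v. in_hub I v \<and> (\<exists>u\<in>C. adj I u v)} \<le> w"
    using hub_component[OF assms(1,2)] by blast
  define H where "H = {v. in_hub I v \<and> (\<exists>u\<in>C. adj I u v)}"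
  have fin: "finite C" "finite H"
    using C(2) hub_bound by (auto simp: H_def intro: finite_subset[of _ "{..<n}"])
  obtain K where K: "set K = {u \<in> C. \<not> assigned A u}" "distinct K"
    using finite_distinct_list[of "{u \<in> C. \<not> assigned A u}"] fin by auto
  obtain S where S: "set S = {u \<in> H. \<not> assigned A u}" "distinct S"
    using finite_distinct_list[of "{u \<in> H. \<not> assigned A u}"] fin by auto
  have "length K \<le> card C" "length S \<le> card H"
    unfolding distinct_card[OF K(2), symmetric] distinct_card[OF S(2), symmetric] K S
    using fin by (auto intro: card_mono)
  then have "length (K @ S) \<le> w" using C(4) unfolding H_def by simp
  then show thesis
    using K S C assms(3) by (intro that[of K S]) (auto simp: H_def)
qed

text \<open>The two states can differ only on \<open>K\<close>, and every neighbour of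
  \<open>K\<close> lies in their common domain.\<close>

lemma safe_same_tail:
  assumes "distinct K" "\<forall>u\<in>set K. \<not> assigned A u \<and> u \<notin> set S"
    "\<forall>u\<in>set K. \<forall>v. adj I u v \<longrightarrow> assigned A v \<or> v \<in> set K \<or> v \<in> set S"
    "B1 \<in> set (extensions q (K @ S) A)" "B2 \<in> set (extensions q (K @ S) A)"
    "drop (length K) B1 = drop (length K) B2"
  shows "safe I B1 B2"
  unfolding safe_def
proof
  fix e assume "e \<in> set B1"
  then have "e \<in> set (take (length K) B1) \<or> e \<in> set (drop (length K) B1)"
    by (metis Un_iff append_take_drop_id set_append)
  then show "snd e = 0 \<or> (\<exists>e'\<in>set B2. fst e' = fst e \<and> snd e' = snd e) \<or> enclosed I B2 (fst e)"
  proof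
    assume "e \<in> set (take (length K) B1)"
    then have "fst e \<in> set (map fst (take (length K) B1))" unfolding set_map by (rule imageI)
    then have "fst e \<in> set K" using extensions_split[OF assms(1,2,4)] by simp
    then have "enclosed I B2 (fst e)"
      using assms(3) extensions_assigned[OF assms(5)] by (auto simp: enclosed_def)
    then show ?thesis by blast
  next
    assume "e \<in> set (drop (length K) B1)"
    then have "e \<in> set B2" unfolding assms(6) by (rule in_set_dropD)
    then show ?thesis by blast
  qed
qed

text \<open>Otherwise the unassigned part \<open>K\<close> of the component of \<open>x\<close> has
  no free hub neighbour, all extensions over \<open>K\<close> are safe for each other, and at most
  one survives. So \<open>K\<close> would be reducible.\<close>

lemma irreducible_all_assigned:
  assumes irr: "\<forall>W\<in>set (words w [0..<n]). \<not> reducible q I A W"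
    and hubs: "\<forall>v. in_hub I v \<longrightarrow> assigned A v" and x: "x < n"
  shows "assigned A x"
proof (rule ccontr)
  assume na: "\<not> assigned A x"
  with hubs have "\<not> in_hub I x" by blast
  obtain K S where KS: "distinct K" "distinct S" "x \<in> set K" "length (K @ S) \<le> w"
    "\<forall>u\<in>set K. u < n \<and> \<not> in_hub I u \<and> \<not> assigned A u"
    "\<forall>u\<in>set S. in_hub I u \<and> \<not> assigned A u"
    "\<forall>u\<in>set K. \<forall>v. adj I u v \<longrightarrow> assigned A v \<or> v \<in> set K \<or> v \<in> set S"
    by (rule component_lists[OF x \<open>\<not> in_hub I x\<close> na]) (rule that)
  have "S = []" using KS(6) hubs by (cases S) auto
  have "1 < length (extensions q K A)"
    using KS(3) na by (rule length_extensions_gt1)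
  moreover have "length (children q I K A) \<le> 1"
  proof -
    have K: "\<forall>u\<in>set K. \<not> assigned A u \<and> u \<notin> set []" using KS(5) by simp
    have enc: "\<forall>u\<in>set K. \<forall>v. adj I u v \<longrightarrow> assigned A v \<or> v \<in> set K \<or> v \<in> set []"
      using KS(7) \<open>S = []\<close> by simp
    have safe: "safe I B1 B2" if "B1 \<in> set (children q I K A)" "B2 \<in> set (children q I K A)" for B1 B2
    proof -
      have B: "B1 \<in> set (extensions q (K @ []) A)" "B2 \<in> set (extensions q (K @ []) A)"
        using children_D(1)[OF that(1)] children_D(1)[OF that(2)] by simp_all
      show ?thesis
        using extensions_split[OF KS(1) K B(1)] extensions_split[OF KS(1) K B(2)]
        by (intro safe_same_tail[OF KS(1) K enc B]) simp
    qed
    have "B1 = B2" if "B1 \<in> set (children q I K A)" "B2 \<in> set (children q I K A)" for B1 B2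
      using keep_inj[of B1 I _ _ B2] that safe[OF that] safe[OF that(2,1)] unfolding children_def by blast
    then have "card (set (children q I K A)) \<le> 1" by (auto simp: card_le_Suc0_iff_eq)
    then show ?thesis using distinct_card[OF distinct_children] by simp
  qed
  moreover have "K \<in> set (words w [0..<n])" using KS(4,5) by (auto simp: set_words)
  ultimately show False using irr by (auto simp: reducible_def)
qed

text \<open>The neighbour \<open>x\<close> stands in the way of giving \<open>v\<close> the first
  colour. Its component is recoloured so that it tolerates this colour at \<open>v\<close>, without
  more deletions. \<open>v\<close> itself stays deleted, so that components can be repaired one
  after the other.\<close>

lemma repair_component:
  assumes A: "wf_state A" and irr: "\<forall>W\<in>set (words w [0..<n]). \<not> reducible q I A W"
    and v: "in_hub I v" "\<not> assigned A v" and g: "col g" "completes g A" "g v = 0"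
    and x: "\<not> in_hub I x" "\<not> assigned A x" "adj I v x" "g x = 1"
  shows "\<exists>g'. col g' \<and> completes g' A \<and> g' v = 0 \<and> total g' \<le> total g \<and>
    {y. adj I v y \<and> g' y = 1} \<subset> {y. adj I v y \<and> g y = 1}"
proof -
  have xn: "x < n" using adj_bound[OF adj_sym[OF x(3)]] .
  obtain K S where KS: "distinct K" "distinct S" "x \<in> set K" "length (K @ S) \<le> w"
    "\<forall>u\<in>set K. u < n \<and> \<not> in_hub I u \<and> \<not> assigned A u"
    "\<forall>u\<in>set S. in_hub I u \<and> \<not> assigned A u"
    "\<forall>u\<in>set K. \<forall>v. adj I u v \<longrightarrow> assigned A v \<or> v \<in> set K \<or> v \<in> set S"
    by (rule component_lists[OF xn x(1,2)]) (rule that)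
  have vS: "v \<in> set S" using KS(3,5,7) adj_sym[OF x(3)] v by blast
  have K: "\<forall>u\<in>set K. \<not> assigned A u \<and> u \<notin> set S" using KS(5,6) by blast
  have W: "\<forall>u\<in>set (K @ S). u < n" using KS(5,6) hub_bound by auto
  let ?ch = "children q I (K @ S) A"
  let ?tail = "drop (length K)"
  have many: "length (extensions q S A) \<le> length ?ch"
  proof -
    have "K @ S \<in> set (words w [0..<n])" using KS(4) W by (auto simp: set_words)
    with irr have "\<not> reducible q I A (K @ S)" by blast
    moreover have "1 < length (extensions q (K @ S) A)"
      by (rule length_extensions_gt1[of x]) (use KS(3) x(2) in auto)
    moreover have "filter (in_hub I) (K @ S) = S"
      using KS(5,6) by (simp add: filter_id_conv filter_empty_conv)
    ultimately show ?thesis unfolding reducible_def by auto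
  qed
  \<comment> \<open>A survivor is determined by its part on \<open>S\<close>, and irreducibility
    provides at least as many survivors as there are assignments of \<open>S\<close>. Hence every
    assignment of \<open>S\<close> has a survivor, in particular \<open>g\<close> with
    \<open>v\<close> in the first colour.\<close>
  have "?tail ` set ?ch = set (extensions q S A)"
  proof (rule card_subset_eq)
    show "finite (set (extensions q S A))" by simp
    show "?tail ` set ?ch \<subseteq> set (extensions q S A)"
      using extensions_split[OF KS(1) K] children_D(1) by blast
    have "inj_on ?tail (set ?ch)"
    proof (rule inj_onI)
      fix B1 B2 assume B: "B1 \<in> set ?ch" "B2 \<in> set ?ch" "?tail B1 = ?tail B2"
      note E = children_D(1)[OF B(1)] children_D(1)[OF B(2)]
      show "B1 = B2"
        using B(1,2) safe_same_tail[OF KS(1) K KS(7) E B(3)] safe_same_tail[OF KS(1) K KS(7) E(2,1) B(3)[symmetric]]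
        unfolding children_def by (rule keep_inj) simp
    qed
    then have "card (?tail ` set ?ch) = length ?ch"
      using distinct_card[OF distinct_children] by (simp add: card_image)
    moreover have "card (set (extensions q S A)) \<le> length (extensions q S A)" by (rule card_length)
    moreover have "card (?tail ` set ?ch) \<le> card (set (extensions q S A))"
      using \<open>?tail ` set ?ch \<subseteq> set (extensions q S A)\<close> by (intro card_mono) auto
    ultimately show "card (?tail ` set ?ch) = card (set (extensions q S A))" using many by linarith
  qed
  moreover have "restrict (g(v := 1)) S A \<in> set (extensions q S A)"
    using g(1) W q_pos by (intro restrict_in_extensions) (auto simp: col_def)
  ultimately obtain B where B: "B \<in> set ?ch" "?tail B = restrict (g(v := 1)) S A" by (metis imageE)
  note BE = children_D(1)[OF B(1)] and valB = children_D(2)[OF B(1)]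
  have wfB: "wf_state B" by (rule extensions_wf[OF A W BE])
  have asB: "assigned B u \<longleftrightarrow> assigned A u \<or> u \<in> set K \<or> u \<in> set S" for u
    using extensions_assigned[OF BE] by auto
  have enc: "enclosed I B u" if "u \<in> set K" for u
    using KS(7) that asB by (auto simp: enclosed_def)
  have tailB: "set (restrict (g(v := 1)) S A) \<subseteq> set B"
    unfolding B(2)[symmetric] by (rule set_drop_subset)
  have SB: "(u, (g(v := 1)) u) \<in> set B" if "u \<in> set S" for u
    using tailB that KS(6) by (auto simp: set_restrict)
  have AB: "set A \<subseteq> set B" using tailB by (auto simp: set_restrict)
  define f where "f = override g B"
  have fB: "completes f B" unfolding f_def by (rule completes_override[OF wfB])
  have fS: "f u = (g(v := 1)) u" if "u \<in> set S" for u
    using SB[OF that] fB unfolding completes_def by fastforce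
  have fA: "completes f A" using fB AB by (auto simp: completes_def)
  have fAg: "f u = g u" if "assigned A u" for u
    using that fA g(2) by (force simp: assigned_def completes_def)
  define B' where "B' = restrict g (K @ S) A"
  \<comment> \<open>The restriction of \<open>g\<close>, which deletes \<open>v\<close>, is safe for
    the survivor \<open>B\<close>, as a deletion never creates a conflict. So deleting
    \<open>v\<close> does not pay off here.\<close>
  have "cost I B \<le> cost I B'"
  proof (rule keep_minimal[OF B(1)[unfolded children_def]])
    show "B' \<in> set (filter (valid I) (extensions q (K @ S) A))"
      unfolding B'_def using g W
      by (auto intro!: restrict_in_extensions col_valid completes_restrict simp: col_def)
    show "safe I B' B"
      unfolding safe_def
    proof
      fix e assume "e \<in> set B'"
      then consider "e \<in> set A" | u where "e = (u, g u)" "u \<in> set K" | u where "e = (u, g u)" "u \<in> set S"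
        unfolding B'_def set_restrict by auto
      then show "snd e = 0 \<or> (\<exists>e'\<in>set B. fst e' = fst e \<and> snd e' = snd e) \<or> enclosed I B (fst e)"
      proof cases
        case 1
        then show ?thesis using AB by blast
      next
        case 2
        then show ?thesis using enc by simp
      next
        case 3
        then show ?thesis using SB[of u] g(3) by (cases "u = v") force+
      qed
    qed
  qed
  moreover have "B = restrict f (K @ S) A" by (rule extensions_eq_restrict[OF BE fB])
  moreover have new: "{u \<in> set (K @ S). \<not> assigned A u} = set K \<union> set S" using KS(5,6) by auto
  ultimately have "(\<Sum>u\<in>set K \<union> set S. pay f u) \<le> (\<Sum>u\<in>set K \<union> set S. pay g u)"
    using cost_restrict[OF fA, of "K @ S"] cost_restrict[OF g(2), of "K @ S"] by (simp only: B'_def new)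
  moreover have disj: "set K \<inter> set S = {}" using K by blast
  moreover have "(\<Sum>u\<in>set S. pay g u) = (\<Sum>u\<in>set S. pay f u) + n"
  proof -
    have "(\<Sum>u\<in>set S - {v}. pay g u) = (\<Sum>u\<in>set S - {v}. pay f u)"
      by (rule sum.cong) (auto simp: pay_def fS)
    moreover have "pay g v = n" "pay f v = 0" using fS[OF vS] g(3) v(1) by (auto simp: pay_def wgt_def)
    ultimately show ?thesis using vS by (simp add: sum.remove[of _ v])
  qed
  ultimately have "(\<Sum>u\<in>set K. pay f u) \<le> (\<Sum>u\<in>set K. pay g u) + n"
    by (simp add: sum.union_disjoint)
  moreover have mult: "(\<Sum>u\<in>set K. pay h u) = Suc n * card {u\<in>set K. h u = 0}" for h
  proof -
    have "(\<Sum>u\<in>set K. pay h u) = (\<Sum>u\<in>{u\<in>set K. h u = 0}. Suc n)"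
      using KS(5) by (intro sum.mono_neutral_cong_right) (auto simp: pay_def wgt_def)
    then show ?thesis by simp
  qed
  \<comment> \<open>A deletion in \<open>K\<close> costs \<open>Suc n\<close>, so the
    \<open>n\<close> saved at \<open>v\<close> do not allow \<open>f\<close> even one more deletion
    in \<open>K\<close> than \<open>g\<close>.\<close>
  ultimately have "Suc n * card {u\<in>set K. f u = 0} < Suc n * Suc (card {u\<in>set K. g u = 0})"
    by simp
  then have "card {u\<in>set K. f u = 0} \<le> card {u\<in>set K. g u = 0}"
    unfolding mult_less_cancel1 by simp
  then have le: "(\<Sum>u\<in>set K. pay f u) \<le> (\<Sum>u\<in>set K. pay g u)"
    unfolding mult by (rule mult_le_mono2)
  \<comment> \<open>Only \<open>K\<close> takes its values from the survivor. On \<open>S\<close>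
    the functions \<open>f\<close> and \<open>g\<close> differ only at \<open>v\<close>, which
    \<open>g\<close> deletes, so the edges between \<open>K\<close> and \<open>S\<close> stay
    proper.\<close>
  define g' where "g' u = (if u \<in> set K then f u else g u)" for u
  have fK: "f a = 0 \<or> f b = 0 \<or> f a \<noteq> f b" if "adj I a b" "assigned B a" "assigned B b" for a b
    unfolding f_def by (rule valid_override_edge[OF wfB valB that])
  have edge: "g' a = 0 \<or> g' b = 0 \<or> g' a \<noteq> g' b" if ab: "adj I a b" "a \<in> set K" for a b
  proof -
    have "assigned A b \<or> b \<in> set K \<or> b \<in> set S" using KS(7) ab by blast
    moreover from this have "f a = 0 \<or> f b = 0 \<or> f a \<noteq> f b" using fK[OF ab(1)] ab(2) asB by blast
    ultimately show ?thesis using ab(2) fAg[of b] fS[of b] g(3) unfolding g'_def by (auto split: if_splits)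
  qed
  have "col g'"
    unfolding col_def
  proof (intro conjI allI impI)
    fix a assume "a < n"
    then show "g' a \<le> q" using g(1) override_le[OF wfB, of g a] by (auto simp: g'_def f_def col_def)
  next
    fix a b assume e: "adj I a b"
    show "g' a = 0 \<or> g' b = 0 \<or> g' a \<noteq> g' b"
    proof (cases "a \<in> set K \<or> b \<in> set K")
      case True
      then show ?thesis using edge[OF e] edge[OF adj_sym[OF e]] by metis
    next
      case False
      then show ?thesis using g(1) e by (simp add: g'_def col_def)
    qed
  qed
  moreover have "completes g' A"
    using fA g(2) by (auto simp: completes_def g'_def)
  moreover have "g' v = 0" using g(3) vS disj by (auto simp: g'_def)
  moreover have "total g' \<le> total g"
  proof -
    have split: "total h = (\<Sum>u\<in>set K. pay h u) + (\<Sum>u\<in>{..<n} - set K. pay h u)" for h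
      unfolding total_def using KS(5) by (subst sum.subset_diff[of "set K"]) auto
    have "(\<Sum>u\<in>{..<n} - set K. pay g' u) = (\<Sum>u\<in>{..<n} - set K. pay g u)"
      by (rule sum.cong) (auto simp: pay_def g'_def)
    moreover have "(\<Sum>u\<in>set K. pay g' u) = (\<Sum>u\<in>set K. pay f u)"
      by (rule sum.cong) (auto simp: pay_def g'_def)
    ultimately show ?thesis unfolding split using le by simp
  qed
  moreover have "{y. adj I v y \<and> g' y = 1} \<subset> {y. adj I v y \<and> g y = 1}"
  proof -
    have "f v = 1" using fS[OF vS] by simp
    then have "f y \<noteq> 1" if "adj I v y" "y \<in> set K" for y
      using fK[OF that(1)] asB vS that(2) by auto
    then have "{y. adj I v y \<and> g' y = 1} \<subseteq> {y. adj I v y \<and> g y = 1} - {x}"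
      using KS(3) by (auto simp: g'_def split: if_splits)
    then show ?thesis using x by blast
  qed
  ultimately show ?thesis by blast
qed

text \<open>Each repaired component reduces the number of neighbours of \<open>v\<close> with value
  \<open>1\<close>.\<close>

lemma repair_all:
  assumes A: "wf_state A" and irr: "\<forall>W\<in>set (words w [0..<n]). \<not> reducible q I A W"
    and v: "in_hub I v" "\<not> assigned A v" and g: "col g" "completes g A" "g v = 0"
  shows "\<exists>g'. col g' \<and> completes g' A \<and> g' v = 0 \<and> total g' \<le> total g \<and> (\<forall>y. adj I v y \<longrightarrow> g' y \<noteq> 1)"
  using g
proof (induction "card {y. adj I v y \<and> g y = 1}" arbitrary: g rule: less_induct)
  case less
  have fin: "finite {y. adj I v y \<and> g y = 1}"
    by (rule finite_subset[of _ "{..<n}"]) (use adj_bound adj_sym in auto)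
  show ?case
  proof (cases "\<exists>x. adj I v x \<and> g x = 1")
    case True
    then obtain x where x: "adj I v x" "g x = 1" by blast
    have xn: "x < n" using adj_bound[OF adj_sym[OF x(1)]] .
    \<comment> \<open>If \<open>x\<close> is assigned or in the hub, then the first colour at both
      \<open>v\<close> and \<open>x\<close> is an invalid extension over \<open>[v]\<close> or
      \<open>[v, x]\<close>, which makes this list reducible. So \<open>x\<close> is an unassigned
      vertex of a component.\<close>
    have no_hub: "False" if W: "W = (if assigned A x then [v] else [v, x])" "assigned A x \<or> in_hub I x" for W
    proof -
      let ?B = "restrict (g(v := 1)) W A"
      have "(v, 1) \<in> set ?B" using v(2) W by (auto simp: set_restrict)
      moreover have "(x, 1) \<in> set ?B"
      proof (cases "assigned A x")
        case True
        then obtain c where "(x, c) \<in> set A" by (rule assignedE)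
        moreover have "c = 1" using less.prems(2) x(2) calculation by (force simp: completes_def)
        ultimately show ?thesis by (auto simp: set_restrict)
      next
        case False
        then show ?thesis using W x(2) by (auto simp: set_restrict)
      qed
      ultimately have "\<not> valid I ?B" using x(1) unfolding valid_def by force
      moreover have "?B \<in> set (extensions q W A)"
        using less.prems(1) hub_bound[OF v(1)] xn q_pos W by (intro restrict_in_extensions) (auto simp: col_def)
      moreover have "\<forall>u\<in>set W. in_hub I u \<and> \<not> assigned A u" "W \<noteq> []" using W v by (auto split: if_splits)
      ultimately have "reducible q I A W" by (intro reducible_invalid)
      moreover have "W \<in> set (words w [0..<n])"
        using W w_ge hub_bound[OF v(1)] xn by (auto simp: set_words)
      ultimately show False using irr by blast
    qed
    then have "\<not> assigned A x" "\<not> in_hub I x" by blast+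
    from repair_component[OF A irr v less.prems this(2,1) x] obtain g' where
      g': "col g'" "completes g' A" "g' v = 0" "total g' \<le> total g"
        "{y. adj I v y \<and> g' y = 1} \<subset> {y. adj I v y \<and> g y = 1}" by blast
    from less.hyps[OF psubset_card_mono[OF fin g'(5)] g'(1-3)] g'(4) show ?thesis
      by (meson order_trans)
  next
    case False
    then show ?thesis using less.prems by blast
  qed
qed

text \<open>Deleting \<open>v\<close> raises the total by at most \<open>n\<close>, repairing the
  components does not raise it, and giving \<open>v\<close> the first colour then saves exactly
  \<open>n\<close>.\<close>

lemma colour_irreducible_hub:
  assumes A: "wf_state A" and irr: "\<forall>W\<in>set (words w [0..<n]). \<not> reducible q I A W"
    and v: "in_hub I v" "\<not> assigned A v" and f: "col f" "completes f A"
  shows "\<exists>f'. col f' \<and> completes f' ((v, 1) # A) \<and> total f' \<le> total f"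
proof -
  have vn: "v < n" using hub_bound[OF v(1)] .
  have split: "total h = pay h v + (\<Sum>u\<in>{..<n} - {v}. pay h u)" for h
    unfolding total_def using vn by (simp add: sum.remove)
  have keepA: "completes (h(v := c)) A" if "completes h A" for h c
    using that v(2) by (auto simp: completes_def assigned_def)
  have other: "(\<Sum>u\<in>{..<n} - {v}. pay (h(v := c)) u) = (\<Sum>u\<in>{..<n} - {v}. pay h u)" for h c
    by (rule sum.cong) (auto simp: pay_def)
  have "col (f(v := 0))" using f(1) by (auto simp: col_def)
  from repair_all[OF A irr v this keepA[OF f(2)]] obtain g where
    g: "col g" "completes g A" "g v = 0" "total g \<le> total (f(v := 0))" "\<forall>y. adj I v y \<longrightarrow> g y \<noteq> 1" by auto
  have "col (g(v := 1))"
    using g(1,5) q_pos adj_sym adj_irrefl by (auto simp: col_def)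
  moreover have "total (g(v := 1)) \<le> total f"
  proof -
    have "total (g(v := 1)) + n = total g"
      unfolding split[of g] split[of "g(v := 1)"] other using g(3) v(1) by (simp add: pay_def wgt_def)
    moreover have "total (f(v := 0)) \<le> total f + n"
      unfolding split[of f] split[of "f(v := 0)"] other using v(1) by (simp add: pay_def wgt_def)
    ultimately show ?thesis using g(4) by simp
  qed
  moreover have "completes (g(v := 1)) ((v, 1) # A)" using keepA[OF g(2)] by simp
  ultimately show ?thesis by blast
qed

section \<open>Invariant and progress of the search\<close>

definition good :: "state \<Rightarrow> bool" where
  "good A \<longleftrightarrow> wf_state A \<and> valid I A"

definition free_hubs :: "state \<Rightarrow> nat" where
  "free_hubs A = card {u. in_hub I u \<and> \<not> assigned A u}"

definition free :: "state \<Rightarrow> nat" where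
  "free A = card {u. u < n \<and> \<not> assigned A u}"

lemma branch_cases:
  obtains (reduce) W where "branch q w I A = children q I W A" "reducible q I A W" "length W \<le> w" "\<forall>u\<in>set W. u < n"
  | (hub) v where "branch q w I A = [(v, 1) # A]" "in_hub I v" "\<not> assigned A v"
      "\<forall>W\<in>set (words w [0..<n]). \<not> reducible q I A W"
  | (finished) "branch q w I A = []" "\<forall>v. in_hub I v \<longrightarrow> assigned A v"
      "\<forall>W\<in>set (words w [0..<n]). \<not> reducible q I A W"
proof (cases "filter (reducible q I A) (words w (vertices I)) = []")
  case False
  from hd_in_set[OF this] False show thesis
    by (intro reduce[of "hd (filter (reducible q I A) (words w (vertices I)))"])
       (auto simp: branch_def Let_def set_words vertices_def)
next
  case irr: True
  let ?U = "filter (\<lambda>v. in_hub I v \<and> \<not> assigned A v) (vertices I)"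
  show thesis
  proof (cases "?U = []")
    case False
    from hd_in_set[OF this] False irr show thesis
      by (intro hub[of "hd ?U"]) (auto simp: branch_def filter_empty_conv vertices_def)
  next
    case True
    with irr hub_bound show thesis
      by (intro finished) (auto simp: branch_def filter_empty_conv vertices_def)
  qed
qed

lemma finite_hubs: "finite {u. in_hub I u \<and> R u}"
  by (rule finite_subset[of _ "{..<n}"]) (use hub_bound in auto)

lemma good_children:
  assumes "good A" "\<forall>u\<in>set W. u < n" "B \<in> set (children q I W A)"
  shows "good B"
  using extensions_wf[OF _ assms(2) children_D(1)[OF assms(3)]] children_D(2)[OF assms(3)] assms(1)
  by (simp add: good_def)

text \<open>Irreducibility of \<open>[v]\<close> alone shows that no choice for \<open>v\<close>
  conflicts with the assigned vertices.\<close>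

lemma good_colour_hub:
  assumes "good A" "in_hub I v" "\<not> assigned A v" "\<forall>W\<in>set (words w [0..<n]). \<not> reducible q I A W"
  shows "good ((v, 1) # A)"
proof -
  have "(v, 1) # A \<in> set (extensions q [v] A)" using assms(3) q_pos by (auto simp: set_extend_at)
  moreover have "\<not> reducible q I A [v]"
    using assms(4) w_ge hub_bound[OF assms(2)] by (auto simp: set_words)
  ultimately have "valid I ((v, 1) # A)"
    using reducible_invalid[of "[v]" A] assms(2,3) by auto
  then show ?thesis
    using assms(1,3) hub_bound[OF assms(2)] q_pos by (auto simp: good_def wf_state_def assigned_def)
qed

text \<open>The exponent drops by the number \<open>k \<le> w\<close> of fresh hub vertices in
  \<open>W\<close>. A reducible \<open>W\<close> has at most one child or at most
  \<open>(q + 1) ^ k - 1\<close> children, and both numbers are at most \<open>b ^ k\<close>.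
  Colouring a hub vertex creates a single child.\<close>

lemma branch_step:
  assumes A: "good A" and B: "B \<in> set (branch q w I A)"
    and b: "1 \<le> b" "\<And>k. k \<le> w \<Longrightarrow> (real q + 1) ^ k \<le> b ^ k + 1"
  shows "good B" "free B < free A" "real (length (branch q w I A)) * b ^ free_hubs B \<le> b ^ free_hubs A"
proof -
  have "good B \<and> free B < free A \<and> real (length (branch q w I A)) * b ^ free_hubs B \<le> b ^ free_hubs A"
  proof (cases A rule: branch_cases)
    case (reduce W)
    then have BW: "B \<in> set (children q I W A)" using B by simp
    note BE = children_D(1)[OF BW]
    let ?H = "{u \<in> set (filter (in_hub I) W). \<not> assigned A u}"
    have "1 < length (extensions q W A)" using reduce(2) by (simp add: reducible_def)
    then have "{u \<in> set W. \<not> assigned A u} \<noteq> {}" unfolding length_extensions by (metis card.empty less_irrefl power_0)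
    then obtain x where x: "x \<in> set W" "\<not> assigned A x" by blast
    have "free B < free A"
      unfolding free_def
    proof (rule psubset_card_mono)
      show "{u. u < n \<and> \<not> assigned B u} \<subset> {u. u < n \<and> \<not> assigned A u}"
        using x reduce(4) extensions_assigned[OF BE] by auto
    qed simp
    moreover have "real (length (children q I W A)) * b ^ free_hubs B \<le> b ^ free_hubs A"
    proof -
      have "{u. in_hub I u \<and> \<not> assigned A u} = ?H \<union> {u. in_hub I u \<and> \<not> assigned B u}"
        using extensions_assigned[OF BE] by auto
      moreover have "?H \<inter> {u. in_hub I u \<and> \<not> assigned B u} = {}"
        using extensions_assigned[OF BE] by auto
      ultimately have hubs: "free_hubs A = card ?H + free_hubs B"
        unfolding free_hubs_def by (simp add: card_Un_disjoint finite_hubs)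
      have "card ?H \<le> length W"
        by (rule order_trans[OF card_mono[of "set W"] card_length]) auto
      with reduce(3) have "card ?H \<le> w" by simp
      from b(2)[OF this] have "real (length (extensions q (filter (in_hub I) W) A)) \<le> b ^ card ?H + 1"
        unfolding length_extensions by (simp add: add.commute)
      moreover have "real (length (children q I W A)) \<le> 1 \<or>
          real (length (children q I W A)) + 1 \<le> real (length (extensions q (filter (in_hub I) W) A))"
        using reduce(2) unfolding reducible_def by auto
      moreover have "1 \<le> b ^ card ?H" using b(1) by (rule one_le_power)
      ultimately have "real (length (children q I W A)) \<le> b ^ card ?H" by linarith
      then show ?thesis unfolding hubs power_add using b(1) by (intro mult_right_mono) auto
    qed
    ultimately show ?thesis using good_children[OF A reduce(4) BW] reduce(1) by simp
  next
    case (hub v)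
    then have B': "B = (v, 1) # A" using B by simp
    have "{u. u < n \<and> \<not> assigned B u} \<subset> {u. u < n \<and> \<not> assigned A u}"
      unfolding B' using hub hub_bound by auto
    then have "free B < free A" unfolding free_def by (intro psubset_card_mono) auto
    moreover have "{u. in_hub I u \<and> \<not> assigned B u} \<subseteq> {u. in_hub I u \<and> \<not> assigned A u}"
      unfolding B' by auto
    then have "free_hubs B \<le> free_hubs A" unfolding free_hubs_def by (intro card_mono finite_hubs)
    then have "real (length (branch q w I A)) * b ^ free_hubs B \<le> b ^ free_hubs A"
      using b(1) hub(1) by (simp add: power_increasing)
    ultimately show ?thesis using good_colour_hub[OF A hub(2-4)] B' by simp
  next
    case finished
    with B show ?thesis by simp
  qed
  then show "good B" "free B < free A" "real (length (branch q w I A)) * b ^ free_hubs B \<le> b ^ free_hubs A"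
    by blast+
qed

lemma branch_sound:
  assumes A: "good A" "branch q w I A \<noteq> []" and f: "col f" "completes f A"
  shows "\<exists>B\<in>set (branch q w I A). \<exists>f'. col f' \<and> completes f' B \<and> total f' \<le> total f"
proof (cases A rule: branch_cases)
  case (reduce W)
  from children_sound[OF _ reduce(4) f] A(1) show ?thesis unfolding reduce(1) good_def by blast
next
  case (hub v)
  from colour_irreducible_hub[OF _ hub(4,2,3) f] A(1) show ?thesis unfolding hub(1) good_def by auto
qed (use A in simp)

text \<open>Deleting every unassigned vertex completes any good state.\<close>

lemma col_override_zero: 
  assumes "good A" shows "col (override (\<lambda>_. 0) A)"
proof -
  have "override (\<lambda>_. 0) A v \<le> q" for v
    using assms override_le[of A "\<lambda>_. 0"] by (simp add: good_def)
  moreover have "override (\<lambda>_. 0) A u = 0 \<or> override (\<lambda>_. 0) A v = 0 \<or> override (\<lambda>_. 0) A u \<noteq> override (\<lambda>_. 0) A v"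
    if "adj I u v" for u v
    using valid_override_edge[OF _ _ that, of A "\<lambda>_. 0"] assms override_unassigned[of A _ "\<lambda>_. 0"]
    by (cases "assigned A u"; cases "assigned A v") (auto simp: good_def)
  ultimately show ?thesis by (simp add: col_def)
qed

lemma branch_Nil:
  assumes "good A" "branch q w I A = []" "x < n"
  shows "assigned A x"
proof (cases A rule: branch_cases)
  case (reduce W)
  \<comment> \<open>A good state has a completion, so branching on a reducible list always leaves a
    child.\<close>
  have "\<exists>B. B \<in> set (children q I W A)"
    using children_sound[OF _ reduce(4) col_override_zero[OF assms(1)]] completes_override assms(1)
    unfolding good_def by blast
  with reduce(1) assms(2) show ?thesis by simp
next
  case (hub v)
  with assms(2) show ?thesis by simp
next
  case finished
  from irreducible_all_assigned[OF finished(3,2) assms(3)] show ?thesis .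
qed

lemma cost_total:
  assumes "wf_state A" "\<forall>x<n. assigned A x" "completes f A"
  shows "cost I A = total f"
proof -
  have "{u. u < n \<and> assigned A u} = {..<n}" using assms(2) by auto
  then show ?thesis using cost_eq_sum[OF assms(1,3)] by (simp add: total_def)
qed

lemma esize_good:
  assumes "good A" shows "esize (I, A) \<le> esize I + n * (n + q + 2) + 1"
proof -
  have "length A = card (fst ` set A)"
    using assms distinct_card[of "map fst A"] by (simp add: good_def wf_state_def)
  also have "\<dots> \<le> card {..<n}"
    using assms by (intro card_mono) (auto simp: good_def wf_state_def)
  finally have "length A \<le> n" by simp
  then have "esize A \<le> n * ((n + q + 1) + 1)"
    using assms by (intro esize_list_le) (fastforce simp: good_def wf_state_def esize_prod)+
  then show ?thesis by simp
qed

end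

section \<open>Graphs with hubs\<close>

definition inst_of :: "nat \<Rightarrow> nat pair_pre_digraph \<Rightarrow> nat set \<Rightarrow> inst" where
  "inst_of n G Q = (map (\<lambda>u. map (\<lambda>v. (u, v) \<in> parcs G) [0..<n]) [0..<n], map (\<lambda>v. v \<in> Q) [0..<n])"

lemma encode_inst_of: "encode (inst_of n G Q) = enc_instance n G Q"
  by (simp add: inst_of_def enc_instance_def enc_graph_def enc_set_def encode_list_def encode_bool_def comp_def)

lemma inst_of_simps:
  "length (fst (inst_of n G Q)) = n"
  "adj (inst_of n G Q) u v \<longleftrightarrow> u < n \<and> v < n \<and> (u, v) \<in> parcs G"
  "in_hub (inst_of n G Q) v \<longleftrightarrow> v < n \<and> v \<in> Q"
  by (auto simp: inst_of_def adj_def in_hub_def hd_drop_conv_nth)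

lemma esize_inst_of: "esize (inst_of n G Q) \<le> n * (2 * n + 1) + 2 * n + 1"
proof -
  have bits: "esize (map R [0..<n]) \<le> n * (1 + 1)" for R :: "nat \<Rightarrow> bool"
    by (rule esize_list_le) (auto simp: encode_bool_def enc_bool_def)
  have "esize (map (\<lambda>u. map (\<lambda>v. (u, v) \<in> parcs G) [0..<n]) [0..<n]) \<le> n * (n * (1 + 1) + 1)"
    by (rule esize_list_le) (use bits in auto)
  then show ?thesis using bits[of "\<lambda>v. v \<in> Q"] by (simp add: inst_of_def algebra_simps)
qed

text \<open>Reachability in a symmetric digraph is symmetric, so a strongly connected component is
  closed under adjacency.\<close>

lemma hub_component_exists:
  assumes "pair_graph G" "hub \<sigma> \<delta> G Q" "x \<in> pverts G - Q"
  obtains K where "x \<in> K" "K \<subseteq> pverts G - Q" "\<And>u v. u \<in> K \<Longrightarrow> (u, v) \<in> parcs G \<Longrightarrow> v \<notin> Q \<Longrightarrow> v \<in> K"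
    "card K \<le> \<sigma>" "card {v \<in> Q. \<exists>u\<in>K. (u, v) \<in> parcs G} \<le> \<delta>"
proof -
  interpret G: pair_graph G by fact
  define H where "H = del_verts G Q"
  have "induced_subgraph H (with_proj G)"
    unfolding H_def del_verts_def by (rule G.induced_induce) simp
  then interpret H: sym_digraph H by (rule G.induced_graph_imp_graph)
  have verts: "verts H = pverts G - Q" by (simp add: H_def del_verts_def)
  have arc: "(u, v) \<in> arcs_ends H" if "(u, v) \<in> parcs G" "u \<in> pverts G - Q" "v \<in> pverts G - Q" for u v
    using that by (auto simp: H_def del_verts_def arcs_ends_conv image_iff intro!: bexI[of _ "(u, v)"])
  obtain C where C: "C \<in> H.sccs" "x \<in> verts C" using H.scc_for_vert_ex[of x] assms(3) verts by auto
  have V: "verts C \<in> H.sccs_verts" using C(1) by (auto simp: H.sccs_verts_conv)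
  show thesis
  proof (rule that[of "verts C"])
    show "x \<in> verts C" by fact
    show sub: "verts C \<subseteq> pverts G - Q" using H.sccs_verts_subsets[OF V] verts by simp
    show "v \<in> verts C" if "u \<in> verts C" "(u, v) \<in> parcs G" "v \<notin> Q" for u v
    proof -
      have "v \<in> pverts G" using G.wellformed(2)[OF that(2)] by simp
      then have "(u, v) \<in> arcs_ends H" using arc that sub by blast
      then have "u \<rightarrow>\<^sup>*\<^bsub>H\<^esub> v" by (rule H.reachable_adjI)
      moreover from this have "v \<rightarrow>\<^sup>*\<^bsub>H\<^esub> u" using symmetric_reachable[OF H.sym_arcs] by blast
      ultimately show ?thesis using V that(1) unfolding H.in_sccs_verts_conv_reachable by blast
    qed
    show "card (verts C) \<le> \<sigma>" "card {v \<in> Q. \<exists>u\<in>verts C. (u, v) \<in> parcs G} \<le> \<delta>"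
      using assms(2) C(1) unfolding hub_def H_def by blast+
  qed
qed

lemma colouring_instance_inst_of:
  assumes "pair_graph G" "pverts G = {..<n}" "hub \<sigma> \<delta> G Q" "1 \<le> q" "0 < \<sigma>" "0 < \<delta>"
  shows "colouring_instance (inst_of n G Q) q (\<sigma> + \<delta>)"
proof -
  interpret G: pair_graph G by fact
  have Q: "Q \<subseteq> {..<n}" using assms(2,3) by (auto simp: hub_def)
  show ?thesis
  proof (unfold_locales, unfold inst_of_simps)
    show "v < n \<and> u < n \<and> (v, u) \<in> parcs G" if "u < n \<and> v < n \<and> (u, v) \<in> parcs G" for u v
      using that G.sym_arcs by (auto simp: symmetric_def sym_def)
    show "\<not> (u < n \<and> u < n \<and> (u, u) \<in> parcs G)" for u
      using G.pair_no_loops by fastforce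
    fix x assume x: "x < n" "\<not> (x < n \<and> x \<in> Q)"
    then have "x \<in> pverts G - Q" using assms(2) by auto
    from hub_component_exists[OF assms(1,3) this] obtain K where K: "x \<in> K" "K \<subseteq> pverts G - Q"
      "\<And>u v. u \<in> K \<Longrightarrow> (u, v) \<in> parcs G \<Longrightarrow> v \<notin> Q \<Longrightarrow> v \<in> K"
      "card K \<le> \<sigma>" "card {v \<in> Q. \<exists>u\<in>K. (u, v) \<in> parcs G} \<le> \<delta>" by blast
    have "{v. (v < n \<and> v \<in> Q) \<and> (\<exists>u\<in>K. u < n \<and> v < n \<and> (u, v) \<in> parcs G)} = {v \<in> Q. \<exists>u\<in>K. (u, v) \<in> parcs G}"
      using K(2) Q assms(2) by auto
    then show "\<exists>K. x \<in> K \<and> (\<forall>u\<in>K. u < n \<and> \<not> (u < n \<and> u \<in> Q)) \<and>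
      (\<forall>u\<in>K. \<forall>v. u < n \<and> v < n \<and> (u, v) \<in> parcs G \<longrightarrow> \<not> (v < n \<and> v \<in> Q) \<longrightarrow> v \<in> K) \<and>
      card K + card {v. (v < n \<and> v \<in> Q) \<and> (\<exists>u\<in>K. u < n \<and> v < n \<and> (u, v) \<in> parcs G)} \<le> \<sigma> + \<delta>"
      using K assms(2) by (intro exI[of _ K]) auto
  qed (use assms in auto)
qed

lemma proper_coloring_del_verts:
  "proper_coloring q (del_verts G X) f \<longleftrightarrow> (\<forall>v\<in>pverts G - X. f v < q) \<and>
    (\<forall>u\<in>pverts G - X. \<forall>v\<in>pverts G - X. (u, v) \<in> parcs G \<longrightarrow> f u \<noteq> f v)"
  unfolding proper_coloring_def del_verts_def arcs_ends_conv by fastforce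

text \<open>The weights exclude a smaller deletion set \<open>Y\<close>: optimality gives
  \<open>n * card X \<le> Suc n * card Y\<close>, and with \<open>card Y < card X\<close> this
  implies \<open>n \<le> card Y\<close>, whereas \<open>card Y < card X \<le> n\<close>.\<close>

lemma (in colouring_instance) minimal_deletion_set:
  assumes G: "pverts G = {..<n}" "\<And>u v. adj I u v \<longleftrightarrow> u < n \<and> v < n \<and> (u, v) \<in> parcs G"
    and f: "col f" "\<And>f'. col f' \<Longrightarrow> total f \<le> total f'"
  shows "min_coloring_deletion_set q G {v. v < n \<and> f v = 0}"
proof -
  let ?X = "{v. v < n \<and> f v = 0}"
  have "proper_coloring q (del_verts G ?X) (\<lambda>v. f v - 1)"
    unfolding proper_coloring_del_verts
  proof (intro conjI ballI impI)
    fix v assume v: "v \<in> pverts G - ?X"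
    then show "f v - 1 < q" using f(1) G(1) by (fastforce simp: col_def)
    fix u assume u: "u \<in> pverts G - ?X" "(v, u) \<in> parcs G"
    then have "f v = 0 \<or> f u = 0 \<or> f v \<noteq> f u" using f(1) v G by (simp add: col_def)
    moreover have "f v \<noteq> 0" "f u \<noteq> 0" using u(1) v unfolding G(1) by simp_all
    ultimately show "f v - 1 \<noteq> f u - 1" by linarith
  qed
  then have del: "coloring_deletion_set q G ?X"
    using G(1) by (auto simp: coloring_deletion_set_def)
  have "card ?X \<le> card Y" if Y: "coloring_deletion_set q G Y" for Y
  proof (rule ccontr)
    assume less: "\<not> card ?X \<le> card Y"
    from Y obtain h where h: "Y \<subseteq> {..<n}" "proper_coloring q (del_verts G Y) h"
      using G(1) by (auto simp: coloring_deletion_set_def)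
    define f' where "f' v = (if v \<in> Y then 0 else Suc (h v))" for v
    have "col f'"
      using h(2) unfolding proper_coloring_del_verts col_def f'_def G by (auto simp: Suc_le_eq)
    have "n * card ?X \<le> total f"
    proof -
      have "n * card ?X = (\<Sum>v\<in>?X. n)" by simp
      also have "\<dots> \<le> (\<Sum>v\<in>?X. pay f v)" by (rule sum_mono) (auto simp: pay_def wgt_def)
      also have "\<dots> \<le> total f" unfolding total_def by (rule sum_mono2) auto
      finally show ?thesis .
    qed
    also have "\<dots> \<le> total f'" by (rule f(2)) fact
    also have "\<dots> \<le> Suc n * card Y"
    proof -
      have "total f' = (\<Sum>v\<in>Y. pay f' v)"
        unfolding total_def using h(1) by (intro sum.mono_neutral_right) (auto simp: pay_def f'_def)
      also have "\<dots> \<le> (\<Sum>v\<in>Y. Suc n)" by (rule sum_mono) (auto simp: pay_def wgt_def)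
      finally show ?thesis by (simp add: mult.commute)
    qed
    finally have "n * card ?X \<le> n * card Y + card Y" by simp
    moreover have "n * Suc (card Y) \<le> n * card ?X" using less by (intro mult_le_mono2) simp
    moreover have "card ?X \<le> card {..<n}" by (rule card_mono) auto
    ultimately show False using less by simp
  qed
  with del show ?thesis
    unfolding min_coloring_deletion_set_def is_arg_min_def by (auto simp: not_less)
qed

section \<open>The algorithm and its running time\<close>

definition deleted :: "inst \<times> state \<Rightarrow> bool list" where
  "deleted s = map (\<lambda>v. \<exists>e\<in>set (snd s). fst e = v \<and> snd e = 0) (vertices (fst s))"

text \<open>With \<open>a = q + 1\<close> and \<open>\<epsilon> = a * \<eta>\<close>, Bernoulli's
  inequality bounds \<open>(a - \<epsilon>) ^ k\<close> from below by
  \<open>a ^ k - k * a ^ k * \<eta>\<close>. The choice of \<open>\<eta>\<close> makes the loss at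
  most 1 for all \<open>k \<le> w\<close> at once and keeps the base at least 1.\<close>

lemma branching_base:
  fixes q w :: nat
  assumes "1 \<le> q" "1 \<le> w"
  obtains \<epsilon> :: real where "0 < \<epsilon>" "1 \<le> real q + 1 - \<epsilon>"
    "\<And>k. k \<le> w \<Longrightarrow> (real q + 1) ^ k \<le> (real q + 1 - \<epsilon>) ^ k + 1"
proof -
  define a where "a = real q + 1"
  have a: "2 \<le> a" using assms(1) by (simp add: a_def)
  define \<eta> where "\<eta> = 1 / (real w * a ^ w)"
  have aw: "a \<le> a ^ w" using power_increasing[of 1 w a] a assms(2) by simp
  have w: "1 \<le> real w" using assms(2) by simp
  have pos: "0 < real w * a ^ w" using a w by auto
  have big: "a \<le> real w * a ^ w" using mult_mono[OF w aw] a by auto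
  have \<eta>: "0 < \<eta>" "a * \<eta> \<le> 1" "\<eta> \<le> 1"
    using pos big a by (auto simp: \<eta>_def field_simps)
  show thesis
  proof (rule that[of "a * \<eta>"])
    show "0 < a * \<eta>" using a \<eta> by simp
    show "1 \<le> real q + 1 - a * \<eta>" using \<eta>(2) a unfolding a_def by linarith
    fix k assume k: "k \<le> w"
    have "a ^ k * (1 + real k * (- \<eta>)) \<le> a ^ k * (1 + (- \<eta>)) ^ k"
      using a \<eta> by (intro mult_left_mono Bernoulli_inequality) auto
    also have "\<dots> = (a - a * \<eta>) ^ k" by (simp add: power_mult_distrib[symmetric] algebra_simps)
    finally have "a ^ k - real k * a ^ k * \<eta> \<le> (a - a * \<eta>) ^ k" by (simp add: algebra_simps)
    moreover have "real k * a ^ k \<le> real w * a ^ w"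
      using k a by (intro mult_mono power_increasing) auto
    then have "real k * a ^ k * \<eta> \<le> 1" unfolding \<eta>_def using pos by simp
    ultimately show "(real q + 1) ^ k \<le> (real q + 1 - a * \<eta>) ^ k + 1" unfolding a_def by linarith
  qed
qed

theorem theorem1p7:
  fixes q \<sigma> \<delta> :: nat
  assumes "q \<ge> 3" and "\<sigma> > 0" and "\<delta> > 0"
  shows "\<exists>\<epsilon>::real. \<epsilon> > 0 \<and>
    (\<exists>(P::program) (K::real) (c::nat).
      \<forall>(n::nat) (G::nat pair_pre_digraph) (Q::nat set).
        pair_graph G \<longrightarrow> pverts G = {..<n} \<longrightarrow> hub \<sigma> \<delta> G Q \<longrightarrow>
        (\<exists>X t. min_coloring_deletion_set q G X \<and>
          computes_in P (enc_instance n G Q) (enc_set n X) t \<and>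
          real t \<le> K * (real q + 1 - \<epsilon>) ^ card Q * real (max 1 n) ^ c))"
proof -
  define w where "w = \<sigma> + \<delta>"
  have w: "1 \<le> w" "1 \<le> q" using assms by (auto simp: w_def)
  obtain \<epsilon> :: real where \<epsilon>: "0 < \<epsilon>" "1 \<le> real q + 1 - \<epsilon>"
    "\<And>k. k \<le> w \<Longrightarrow> (real q + 1) ^ k \<le> (real q + 1 - \<epsilon>) ^ k + 1"
    by (rule branching_base[OF w(2,1)]) (rule that)
  define b where "b = real q + 1 - \<epsilon>"
  have b: "1 \<le> b" "\<And>k. k \<le> w \<Longrightarrow> (real q + 1) ^ k \<le> b ^ k + 1"
    using \<epsilon> by (auto simp: b_def)
  \<comment> \<open>Each search state carries the instance, so that \<open>step\<close> and
    \<open>pick\<close> have access to it.\<close>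
  define step where "step s = map (\<lambda>B. (fst s, B)) (branch q w (fst s) (snd s))" for s :: "inst \<times> state"
  define pick where "pick p = (if cost (fst (fst p)) (snd (fst p)) \<le> cost (fst (snd p)) (snd (snd p)) then fst p else snd p)"
    for p :: "(inst \<times> state) \<times> (inst \<times> state)"
  have "ptime step" unfolding step_def by (intro ptime_map ptime_branch ptime_Pair ptime_fst ptime_snd ptime_id)
  moreover have "ptime pick" unfolding pick_def by (intro ptime_if ptime_le ptime_cost ptime_fst ptime_snd ptime_id)
  ultimately obtain PS T where T: "poly_in (\<lambda>N. N) T" and search:
    "\<forall>D N \<mu> \<nu> b Res Best. search_problem step pick D N \<mu> \<nu> b Res Best \<longrightarrow> (\<forall>s\<in>D.
      \<exists>r t. Res s r \<and> computes_in PS (encode s) (encode r) t \<and> real t \<le> real (T N) * (real (\<mu> s) + 1) * b ^ \<nu> s)"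
    by (rule tree_search) (rule that)
  have "ptime (\<lambda>I :: inst. (I, [] :: state))" by (intro ptime_intros)
  from ptimeE[OF this] obtain PI ci where
    init: "\<And>I :: inst. \<exists>t \<le> ci * (esize I + 1) ^ ci. computes_in PI (encode I) (encode (I, [] :: state)) t" by blast
  have "ptime deleted" unfolding deleted_def by (intro ptime_intros ptime_vertices)
  from ptimeE[OF this] obtain PO co where
    out: "\<And>s. \<exists>t \<le> co * (esize s + 1) ^ co. computes_in PO (encode s) (encode (deleted s)) t" by blast
  obtain P1 where P1: "\<And>x y z t1 t2. computes_in PI x y t1 \<Longrightarrow> computes_in PS y z t2 \<Longrightarrow> computes_in P1 x z (t1 + t2 + 3)"
    by (rule computes_in_comp) (rule that)
  obtain P where P: "\<And>x y z t1 t2. computes_in P1 x y t1 \<Longrightarrow> computes_in PO y z t2 \<Longrightarrow> computes_in P x z (t1 + t2 + 3)"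
    by (rule computes_in_comp) (rule that)
  define N where "N n = n * (2 * n + 1) + 2 * n + 1 + n * (n + q + 2) + 1" for n
  \<comment> \<open>Preprocessing, search and output. The factor \<open>n + 1\<close> comes from the
    depth measure, which is \<open>n\<close> at the root, and 6 from two compositions at 3 steps
    each.\<close>
  define F where "F n = ci * (N n + 1) ^ ci + T (N n) * (n + 1) + co * (N n + 1) ^ co + 6" for n
  have "poly_in (\<lambda>n. n) F"
  proof -
    have N: "poly_in (\<lambda>n. n) N" unfolding N_def by (intro poly_intros)
    have "poly_in (\<lambda>n. n) (\<lambda>n. T (N n))"
      using poly_in_comp[OF T, of N] N by (rule poly_in_trans)
    then show ?thesis unfolding F_def by (intro poly_intros N)
  qed
  then obtain c where c: "\<forall>n. F n \<le> c * (n + 1) ^ c" unfolding poly_in_def ..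
  have main: "\<exists>X t. min_coloring_deletion_set q G X \<and> computes_in P (enc_instance n G Q) (enc_set n X) t \<and>
      real t \<le> real (c * 2 ^ c) * b ^ card Q * real (max 1 n) ^ c"
    if G: "pair_graph G" "pverts G = {..<n}" "hub \<sigma> \<delta> G Q" for n G Q
  proof -
    define I where "I = inst_of n G Q"
    interpret colouring_instance I q w
      unfolding I_def w_def using assms by (intro colouring_instance_inst_of G) auto
    have len: "length (fst I) = n" by (simp add: I_def inst_of_simps)
    have hubQ: "in_hub I v \<longleftrightarrow> v \<in> Q" for v
      using G(2,3) by (auto simp: I_def inst_of_simps hub_def)
    have NI: "esize I + n * (n + q + 2) + 1 \<le> N n"
      using esize_inst_of[of n G Q] by (simp add: N_def I_def)
    define D where "D = {(I, A) | A. good A}"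
    define fin where "fin r \<longleftrightarrow> r \<in> D \<and> (\<forall>x<n. assigned (snd r) x)" for r :: "inst \<times> state"
    \<comment> \<open>The answer need not extend \<open>s\<close>; together with \<open>fin\<close>
      it suffices that it is a complete good state at most as expensive as every completion of
      \<open>s\<close>. So the cheaper of two answers serves both sides.\<close>
    define below where "below s r \<longleftrightarrow> (\<forall>f. col f \<longrightarrow> completes f (snd s) \<longrightarrow> cost I (snd r) \<le> total f)" for s r :: "inst \<times> state"
    have D: "fst s = I" "good (snd s)" if "s \<in> D" for s using that by (auto simp: D_def)
    interpret search_problem step pick D "N n" "\<lambda>s. free (snd s)" "\<lambda>s. free_hubs (snd s)" b
      "\<lambda>s r. fin r \<and> below s r" "\<lambda>cs r. fin r \<and> (\<forall>c\<in>set cs. below c r)"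
    proof
      show "esize s \<le> N n" if "s \<in> D" for s
        using esize_good NI that unfolding D_def len by fastforce
      show "c \<in> D \<and> free (snd c) < free (snd s) \<and> real (length (step s)) * b ^ free_hubs (snd c) \<le> b ^ free_hubs (snd s)"
        if s: "s \<in> D" "c \<in> set (step s)" for s c
      proof -
        from s D[OF s(1)] obtain B where B: "B \<in> set (branch q w I (snd s))" "c = (I, B)" by (auto simp: step_def)
        from branch_step[OF D(2)[OF s(1)] B(1) b] show ?thesis
          using D[OF s(1)] B(2) by (simp add: D_def step_def)
      qed
      show "fin s \<and> below s s" if s: "s \<in> D" "step s = []" for s
      proof -
        have "branch q w I (snd s) = []" using s D[OF s(1)] by (simp add: step_def)
        then have "\<forall>x<n. assigned (snd s) x" using branch_Nil[OF D(2)[OF s(1)]] len by blast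
        then show ?thesis
          using s(1) D(2)[OF s(1)] cost_total[of "snd s"] len by (auto simp: fin_def below_def good_def)
      qed
      show "fin r \<and> below s r" if s: "s \<in> D" "step s \<noteq> []" "fin r \<and> (\<forall>c\<in>set (step s). below c r)" for s r
        unfolding below_def
      proof (intro conjI allI impI)
        show "fin r" using s(3) by blast
        fix f assume f: "col f" "completes f (snd s)"
        have "branch q w I (snd s) \<noteq> []" using s(2) D[OF s(1)] by (simp add: step_def)
        from branch_sound[OF D(2)[OF s(1)] this f] obtain B f' where
          B: "B \<in> set (branch q w I (snd s))" "col f'" "completes f' B" "total f' \<le> total f" by blast
        have "below (I, B) r" using s(3) B(1) D[OF s(1)] by (auto simp: step_def)
        with B(2-4) show "cost I (snd r) \<le> total f" unfolding below_def by fastforce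
      qed
      show "fin (pick (r, r')) \<and> (\<forall>c\<in>set (c # cs). below c (pick (r, r')))"
        if r: "fin r \<and> below c r" "fin r' \<and> (\<forall>c\<in>set cs. below c r')" for c cs r r'
      proof -
        have "fst r = I" "fst r' = I" using r D by (auto simp: fin_def)
        then show ?thesis using r unfolding pick_def below_def by (auto intro: order_trans)
      qed
    qed (use b in \<open>auto simp: fin_def\<close>)
    have "(I, []) \<in> D" by (auto simp: D_def good_def wf_state_def valid_def)
    with search search_problem_axioms have "\<exists>r t. (fin r \<and> below (I, []) r) \<and>
        computes_in PS (encode (I, [] :: state)) (encode r) t \<and>
        real t \<le> real (T (N n)) * (real (free (snd (I, [] :: state))) + 1) * b ^ free_hubs (snd (I, [] :: state))"
      by blast
    then obtain r t where r: "fin r" "below (I, []) r" "computes_in PS (encode (I, [] :: state)) (encode r) t"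
      "real t \<le> real (T (N n)) * (real (free []) + 1) * b ^ free_hubs []" by auto
    define A where "A = snd r"
    have rI: "r = (I, A)" "good A" "\<forall>x<n. assigned A x"
      using r(1) D by (auto simp: fin_def A_def prod_eq_iff)
    \<comment> \<open>All vertices below \<open>n\<close> are assigned in \<open>A\<close>, so the
      default value concerns none of them.\<close>
    define f where "f = override (\<lambda>_. 0) A"
    have f: "col f" unfolding f_def by (rule col_override_zero[OF rI(2)])
    have fA: "completes f A" unfolding f_def using rI(2) by (intro completes_override) (simp add: good_def)
    have cost: "cost I A = total f" using rI(2,3) fA len by (intro cost_total) (auto simp: good_def)
    have min: "min_coloring_deletion_set q G {v. v < n \<and> f v = 0}"
      using minimal_deletion_set[of G f, unfolded len] G(2) f r(2) cost
      by (simp add: below_def A_def[symmetric] completes_def I_def inst_of_simps)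
    have "(\<exists>e\<in>set A. fst e = v \<and> snd e = 0) \<longleftrightarrow> f v = 0" if v: "v < n" for v
    proof -
      from rI(3) v obtain d where d: "(v, d) \<in> set A" by (auto elim: assignedE)
      then show ?thesis using fA unfolding completes_def by force
    qed
    then have out_enc: "encode (deleted (I, A)) = enc_set n {v. v < n \<and> f v = 0}"
      by (auto simp: deleted_def vertices_def len enc_set_def encode_list_def encode_bool_def comp_def
          intro!: arg_cong[of _ _ enc_list])
    obtain t1 where t1: "t1 \<le> ci * (esize I + 1) ^ ci" "computes_in PI (encode I) (encode (I, [] :: state)) t1"
      using init by blast
    obtain t3 where t3: "t3 \<le> co * (esize (I, A) + 1) ^ co" "computes_in PO (encode (I, A)) (encode (deleted (I, A))) t3"
      using out by blast
    have run: "computes_in P (enc_instance n G Q) (enc_set n {v. v < n \<and> f v = 0}) ((t1 + t + 3) + t3 + 3)"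
      using P[OF P1[OF t1(2) r(3)] t3(2)[folded rI(1)]] unfolding rI(1) out_enc by (simp add: I_def encode_inst_of)
    have frees: "free [] = n" "free_hubs [] = card Q"
      unfolding free_def free_hubs_def len using hubQ by auto
    have "real ((t1 + t + 3) + t3 + 3) \<le> real (F n) * b ^ card Q"
    proof -
      define Y where "Y = ci * (N n + 1) ^ ci + co * (N n + 1) ^ co + 6"
      have one: "1 \<le> b ^ card Q" using b(1) by (rule one_le_power)
      have "t1 \<le> ci * (N n + 1) ^ ci"
        by (rule order_trans[OF t1(1)]) (use NI in \<open>intro mult_le_mono2 power_mono; simp\<close>)
      moreover have "t3 \<le> co * (N n + 1) ^ co"
        by (rule order_trans[OF t3(1)]) (use NI esize_good[OF rI(2)] len in \<open>intro mult_le_mono2 power_mono; simp\<close>)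
      ultimately have "t1 + t3 + 6 \<le> Y" unfolding Y_def by linarith
      then have "real t1 + real t3 + 6 \<le> real Y * 1" by linarith
      also have "\<dots> \<le> real Y * b ^ card Q" using one by (intro mult_left_mono) auto
      finally have "real t1 + real t3 + 6 \<le> real Y * b ^ card Q" .
      moreover have "real t \<le> real (T (N n) * (n + 1)) * b ^ card Q"
        using r(4) unfolding frees by (simp add: algebra_simps)
      moreover have "real (F n) = real Y + real (T (N n) * (n + 1))" unfolding F_def Y_def by simp
      ultimately show ?thesis by (simp add: algebra_simps)
    qed
    also have "\<dots> \<le> real (c * 2 ^ c) * real (max 1 n) ^ c * b ^ card Q"
    proof (rule mult_right_mono)
      have "F n \<le> c * (n + 1) ^ c" using c by blast
      \<comment> \<open>\<open>n + 1 \<le> 2 * max 1 n\<close> also holds for \<open>n = 0\<close>;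
        it accounts for the factor \<open>2 ^ c\<close>.\<close>
      also have "\<dots> \<le> c * (2 * max 1 n) ^ c" by (intro mult_le_mono2 power_mono) auto
      also have "\<dots> = c * 2 ^ c * max 1 n ^ c" by (simp add: power_mult_distrib)
      finally show "real (F n) \<le> real (c * 2 ^ c) * real (max 1 n) ^ c"
        by (metis of_nat_le_iff of_nat_mult of_nat_power)
    qed (use b(1) in auto)
    finally show ?thesis using min run by (auto simp: algebra_simps intro!: exI)
  qed
  show ?thesis
    using \<epsilon>(1) main unfolding b_def by blast
qed

end
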